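(* Let $B$ be the subgroup of upper-triangular matrices in $SL_2(\mathbb R)$. Then the embedding $B\to SL_2(\mathbb R)$ is an epimorphism in the category of Banach--Lie groups; that is, for every Banach--Lie group $K$ and any two Banach--Lie group morphisms $\varphi,\psi:SL_2(\mathbb R)\to K$ with $\varphi|_B=\psi|_B$, one has $\varphi=\psi$.
   Context: A Banach--Lie group is a real Lie group in the sense of Bourbaki, i.e. a group that is a (real analytic) manifold modelled on a real Banach space with (analytic) smooth group operations; morphisms are (analytic) smooth group homomorphisms. A morphism $f:A\to C$ in a category is an epimorphism if for any object $Z$ and any morphisms $g_1,g_2:C\to Z$, the equality $g_1f=g_2f$ implies $g_1=g_2$. *)

theory Defs
  imports "HOL-Analysis.Analysis" "HOL-Algebra.Group"
begin

section \<open>Real analytic maps between Banach spaces\<close>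

text \<open>An \<open>n\<close>-linear map is encoded as a function of sequences that depends only on the
  entries with index below \<open>n\<close> and is linear in each of them.\<close>

definition multilinear :: "nat \<Rightarrow> ((nat \<Rightarrow> 'a::real_vector) \<Rightarrow> 'b::real_vector) \<Rightarrow> bool" where
  "multilinear n m \<longleftrightarrow>
     (\<forall>v w. (\<forall>i<n. v i = w i) \<longrightarrow> m v = m w) \<and>
     (\<forall>v. \<forall>i<n. linear (\<lambda>x. m (v(i := x))))"

text \<open>\<open>f\<close> is analytic at \<open>a\<close> if near \<open>a\<close> it is the sum of a convergent power series, that is, of
  a series of continuous homogeneous polynomials \<open>h \<mapsto> m n (h, \<dots>, h)\<close>; the geometric bound on
  the norms of the multilinear maps \<open>m n\<close> says that the radius of convergence is positive.\<close>

definition real_analytic_at ::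
    "('a::real_normed_vector \<Rightarrow> 'b::real_normed_vector) \<Rightarrow> 'a \<Rightarrow> bool" where
  "real_analytic_at f a \<longleftrightarrow>
     (\<exists>(m :: nat \<Rightarrow> (nat \<Rightarrow> 'a) \<Rightarrow> 'b) C R r. 0 < R \<and> 0 < r \<and>
        (\<forall>n. multilinear n (m n)) \<and>
        (\<forall>n v. norm (m n v) \<le> C * R ^ n * (\<Prod>i<n. norm (v i))) \<and>
        (\<forall>h. norm h < r \<longrightarrow> (\<lambda>n. m n (\<lambda>_. h)) sums f (a + h)))"

definition real_analytic_on ::
    "('a::real_normed_vector \<Rightarrow> 'b::real_normed_vector) \<Rightarrow> 'a set \<Rightarrow> bool" where
  "real_analytic_on f S \<longleftrightarrow> open S \<and> (\<forall>a\<in>S. real_analytic_at f a)"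


section \<open>Real analytic manifolds modelled on a Banach space\<close>

text \<open>A chart is a pair of its domain and its coordinate map, whose values off the domain are
  irrelevant. The atlas need not be maximal; it stands for the analytic structure it generates.\<close>

record ('a, 'e) manifold =
  mtop :: "'a topology"
  atlas :: "('a set \<times> ('a \<Rightarrow> 'e)) set"

definition chart :: "'a topology \<Rightarrow> 'a set \<Rightarrow> ('a \<Rightarrow> 'e::banach) \<Rightarrow> bool" where
  "chart X U \<phi> \<longleftrightarrow> openin X U \<and> open (\<phi> ` U) \<and>
     homeomorphic_map (subtopology X U) (top_of_set (\<phi> ` U)) \<phi>"

definition analytic_manifold :: "('a, 'e::banach) manifold \<Rightarrow> bool" where
  "analytic_manifold M \<longleftrightarrow>
     (\<forall>(U, \<phi>)\<in>atlas M. chart (mtop M) U \<phi>) \<and>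
     (\<Union>(U, \<phi>)\<in>atlas M. U) = topspace (mtop M) \<and>
     (\<forall>(U, \<phi>)\<in>atlas M. \<forall>(V, \<psi>)\<in>atlas M.
        real_analytic_on (\<psi> \<circ> the_inv_into U \<phi>) (\<phi> ` (U \<inter> V)))"

definition analytic_map ::
    "('a, 'e::banach) manifold \<Rightarrow> ('b, 'f::banach) manifold \<Rightarrow> ('a \<Rightarrow> 'b) \<Rightarrow> bool" where
  "analytic_map M N f \<longleftrightarrow>
     continuous_map (mtop M) (mtop N) f \<and>
     (\<forall>(U, \<phi>)\<in>atlas M. \<forall>(V, \<psi>)\<in>atlas N.
        real_analytic_on (\<psi> \<circ> f \<circ> the_inv_into U \<phi>) (\<phi> ` {x\<in>U. f x \<in> V}))"

definition prod_manifold ::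
    "('a, 'e::banach) manifold \<Rightarrow> ('b, 'f::banach) manifold \<Rightarrow> ('a \<times> 'b, 'e \<times> 'f) manifold" where
  "prod_manifold M N =
     \<lparr>mtop = prod_topology (mtop M) (mtop N),
      atlas = {(U \<times> V, map_prod \<phi> \<psi>) |U \<phi> V \<psi>. (U, \<phi>) \<in> atlas M \<and> (V, \<psi>) \<in> atlas N}\<rparr>"


section \<open>Banach--Lie groups and their epimorphisms\<close>

record ('a, 'e) lie_group = "'a monoid" +
  manifold :: "('a, 'e) manifold"

text \<open>As in Bourbaki, no separation axiom is imposed: a locally Hausdorff topological group is
  Hausdorff. Using one model space for all charts is no restriction, since translations identify
  all tangent spaces.\<close>

definition banach_lie_group :: "('a, 'e::banach) lie_group \<Rightarrow> bool" where
  "banach_lie_group G \<longleftrightarrow>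
     group G \<and>
     analytic_manifold (manifold G) \<and>
     topspace (mtop (manifold G)) = carrier G \<and>
     analytic_map (prod_manifold (manifold G) (manifold G)) (manifold G)
       (\<lambda>(x, y). x \<otimes>\<^bsub>G\<^esub> y) \<and>
     analytic_map (manifold G) (manifold G) (m_inv G)"

definition banach_lie_hom ::
    "('a, 'e::banach) lie_group \<Rightarrow> ('b, 'f::banach) lie_group \<Rightarrow> ('a \<Rightarrow> 'b) set" where
  "banach_lie_hom G H = {f \<in> hom G H. analytic_map (manifold G) (manifold H) f}"

text \<open>A definition cannot quantify over types, so the types of elements and of the model space of
  the test objects are parameters. A theorem in which these are type variables
  is universal over all Banach--Lie groups. Morphisms are compared on the carrier only.\<close>

definition banach_lie_epimorphism ::
    "'k itself \<Rightarrow> 'z::banach itself \<Rightarrow>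
     ('a, 'e::banach) lie_group \<Rightarrow> ('b, 'f::banach) lie_group \<Rightarrow> ('a \<Rightarrow> 'b) \<Rightarrow> bool" where
  "banach_lie_epimorphism _ _ A C f \<longleftrightarrow>
     banach_lie_group A \<and> banach_lie_group C \<and> f \<in> banach_lie_hom A C \<and>
     (\<forall>K :: ('k, 'z) lie_group. banach_lie_group K \<longrightarrow>
        (\<forall>\<phi>\<in>banach_lie_hom C K. \<forall>\<psi>\<in>banach_lie_hom C K.
           (\<forall>x\<in>carrier A. \<phi> (f x) = \<psi> (f x)) \<longrightarrow> (\<forall>y\<in>carrier C. \<phi> y = \<psi> y)))"


section \<open>The group of real 2 by 2 matrices of determinant 1 and its upper triangular subgroup\<close>

text \<open>The analytic structure is that of a submanifold of the space of matrices. Since the first row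
  of an invertible matrix is nonzero, two charts suffice: where the entry (1,1) is nonzero, the
  entry (2,2) is determined by the other three; where the entry (1,2) is nonzero, the entry (2,1)
  is.\<close>

definition SL2R :: "(real^2^2, real \<times> real \<times> real) lie_group" where
  "SL2R =
     \<lparr>carrier = {A. det A = 1}, mult = (**), one = mat 1,
      manifold =
        \<lparr>mtop = top_of_set {A. det A = 1},
         atlas = {({A. det A = 1 \<and> A$1$1 \<noteq> 0}, \<lambda>A. (A$1$1, A$1$2, A$2$1)),
                  ({A. det A = 1 \<and> A$1$2 \<noteq> 0}, \<lambda>A. (A$1$1, A$1$2, A$2$2))}\<rparr>\<rparr>"

definition SL2R_upper :: "(real^2^2, real \<times> real) lie_group" where
  "SL2R_upper =
     \<lparr>carrier = {A. det A = 1 \<and> A$2$1 = 0}, mult = (**), one = mat 1,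
      manifold =
        \<lparr>mtop = top_of_set {A. det A = 1 \<and> A$2$1 = 0},
         atlas = {({A. det A = 1 \<and> A$2$1 = 0}, \<lambda>A. (A$1$1, A$1$2))}\<rparr>\<rparr>"

end

theory Submission
  imports Defs
begin

text \<open>Let \<open>\<phi>\<close> and \<open>\<psi>\<close> agree on the upper triangular group \<open>B\<close>, let \<open>n s\<close> be the lower unipotent
  matrix with entry \<open>s\<close>, and put \<open>D s = \<phi> (n s) (\<psi> (n s))\<inverse>\<close>. If \<open>b (n s) = (n s') b'\<close> with \<open>b, b'\<close>
  in \<open>B\<close>, then \<open>D s' = \<phi> b (D s) (\<phi> b)\<inverse>\<close>. If \<open>D\<close> is not constant near 0, let \<open>d s^k\<close>, with \<open>k > 0\<close>, be
  the leading term of \<open>D\<close> at 0 in a chart around the identity; comparing leading terms shows that, under the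
  adjoint representation on the model space, \<open>d\<close> is fixed by the upper unipotents and scaled by
  \<open>a^(-2k)\<close> under \<open>diag (a, 1/a)\<close>. A highest weight vector of negative weight cannot exist in a
  norm-continuous representation on a Banach space, so \<open>D\<close> is trivial near 0, hence everywhere by
  conjugation with diagonal matrices. The lower unipotents together with \<open>B\<close> generate the group.\<close>

section \<open>Real analytic maps\<close>

text \<open>On \<open>B\<close> the two homomorphisms agree, so in
  \<open>b (n s) = (n s') b'\<close> the factor from \<open>b'\<close> is common to both and cancels
  in \<open>D\<close>; only conjugation by \<open>\<phi> b\<close> survives. For
  \<open>b = diag (a, 1/a)\<close> this gives \<open>s' = a^(-2) s\<close>, and for an upper
  unipotent with entry \<open>t\<close> it gives \<open>s' = s / (1 + t s)\<close>, which equals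
  \<open>s\<close> to first order: hence the weight and the invariance of \<open>d\<close>.
  Analyticity rules out a \<open>D\<close> that is nontrivial near 0 but flat there.

  The obstacle is that the model space may be infinite-dimensional: \<open>d\<close> need not lie in
  a finite-dimensional invariant subspace, so the classification of weights does not apply. A growth
  argument replaces it. A diagonal matrix conjugates a lower unipotent \<open>P\<close> near the
  identity to \<open>P^2\<close>, and boundedness of that single operator forces
  \<open>P - 1\<close> to be nilpotent on \<open>d\<close>. So \<open>P^j d\<close> is polynomial in
  \<open>j\<close>, while the Bruhat decomposition makes it tend to 0.\<close>

lemma multilinearI:
  assumes "\<And>v w. (\<And>i. i < n \<Longrightarrow> v i = w i) \<Longrightarrow> m v = m w"
    and "\<And>v i. i < n \<Longrightarrow> linear (\<lambda>x. m (v(i := x)))"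
  shows "multilinear n m"
  using assms unfolding multilinear_def by blast

lemma multilinear_cong:
  assumes "multilinear n m" "\<And>i. i < n \<Longrightarrow> v i = w i"
  shows "m v = m w"
  using assms unfolding multilinear_def by blast

lemma multilinear_linear:
  assumes "multilinear n m" "i < n"
  shows "linear (\<lambda>x. m (v(i := x)))"
  using assms unfolding multilinear_def by blast

lemma real_analytic_atE:
  assumes "real_analytic_at f a"
  obtains m C R r where "0 < R" "0 < r" "0 \<le> C" "\<And>n. multilinear n (m n)"
    "\<And>n v. norm (m n v) \<le> C * R ^ n * (\<Prod>i<n. norm (v i))"
    "\<And>h. norm h < r \<Longrightarrow> (\<lambda>n. m n (\<lambda>_. h)) sums f (a + h)"
proof -
  obtain m C R r where *: "0 < R" "0 < r" "\<And>n. multilinear n (m n)"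
    "\<And>n v. norm (m n v) \<le> C * R ^ n * (\<Prod>i<n. norm (v i))"
    "\<And>h. norm h < r \<Longrightarrow> (\<lambda>n. m n (\<lambda>_. h)) sums f (a + h)"
    using assms unfolding real_analytic_at_def by metis
  \<comment> \<open>For \<open>n = 0\<close> the bound reads \<open>norm (m 0 v) \<le> C\<close>,
    the product being empty.\<close>
  have "0 \<le> C" using *(4)[of 0 undefined] norm_ge_zero[of "m 0 undefined"] by (simp del: norm_ge_zero)
  with * show ?thesis using that by blast
qed

lemma real_analytic_atI:
  assumes "0 < R" "0 < r" "\<And>n. multilinear n (m n)"
    "\<And>n v. norm (m n v) \<le> C * R ^ n * (\<Prod>i<n. norm (v i))"
    "\<And>h. norm h < r \<Longrightarrow> (\<lambda>n. m n (\<lambda>_. h)) sums f (a + h)"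
  shows "real_analytic_at f a"
  unfolding real_analytic_at_def using assms by blast

lemma real_analytic_at_transform:
  assumes "real_analytic_at f a" "open S" "a \<in> S" "\<And>x. x \<in> S \<Longrightarrow> f x = g x"
  shows "real_analytic_at g a"
proof -
  obtain m C R r where *: "0 < R" "0 < r" "0 \<le> C" "\<And>n. multilinear n (m n)"
    "\<And>n v. norm (m n v) \<le> C * R ^ n * (\<Prod>i<n. norm (v i))"
    "\<And>h. norm h < r \<Longrightarrow> (\<lambda>n. m n (\<lambda>_. h)) sums f (a + h)"
    using real_analytic_atE[OF assms(1)] by metis
  obtain e where e: "e > 0" "ball a e \<subseteq> S" using assms(2,3) openE by blast
  show ?thesis
  proof (rule real_analytic_atI[where m=m and C=C and R=R and r="min r e"])
    fix h :: 'a assume h: "norm h < min r e"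
    then have "a + h \<in> S" using e by (auto simp: dist_norm)
    then show "(\<lambda>n. m n (\<lambda>_. h)) sums g (a + h)" using *(6) h assms(4) by force
  qed (use * e in auto)
qed

lemma prod_norm_bound:
  assumes "\<And>i. norm (v i) \<le> B * norm (w i)" "0 \<le> B"
  shows "(\<Prod>i<n. norm (v i)) \<le> B ^ n * (\<Prod>i<(n::nat). norm (w i))"
proof -
  have "(\<Prod>i<n. norm (v i)) \<le> (\<Prod>i<n. B * norm (w i))"
    by (rule prod_mono) (use assms in auto)
  then show ?thesis by (simp add: prod.distrib)
qed

section \<open>Closure of analyticity under linear maps, sums, products and inverses\<close>

lemma real_analytic_at_bounded_linear_compose:
  fixes f :: "'a::real_normed_vector \<Rightarrow> 'b::real_normed_vector" and L :: "'b \<Rightarrow> 'c::real_normed_vector"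
  assumes "real_analytic_at f a" "bounded_linear L"
  shows "real_analytic_at (\<lambda>x. L (f x)) a"
proof -
  interpret L: bounded_linear L by fact
  obtain m C R r where *: "0 < R" "0 < r" "0 \<le> C" "\<And>n. multilinear n (m n)"
    "\<And>n v. norm (m n v) \<le> C * R ^ n * (\<Prod>i<n. norm (v i))"
    "\<And>h. norm h < r \<Longrightarrow> (\<lambda>n. m n (\<lambda>_. h)) sums f (a + h)"
    using real_analytic_atE[OF assms(1)] by metis
  obtain B where B: "0 < B" "\<And>x. norm (L x) \<le> norm x * B" using L.pos_bounded by blast
  show ?thesis
  proof (rule real_analytic_atI[where m="\<lambda>n v. L (m n v)" and C="C*B" and R=R and r=r])
    fix n
    show "multilinear n (\<lambda>v. L (m n v))"
    proof (rule multilinearI)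
      fix v :: "nat \<Rightarrow> 'a" and i assume "i < n"
      show "linear (\<lambda>x. L (m n (v(i := x))))"
        using linear_compose[OF multilinear_linear[OF *(4) \<open>i < n\<close>] L.linear] by (simp add: o_def)
    qed (rule arg_cong[where f=L], rule multilinear_cong[OF *(4)], auto)
  next
    fix n v
    have "norm (L (m n v)) \<le> norm (m n v) * B" by (rule B)
    also have "\<dots> \<le> C * R ^ n * (\<Prod>i<n. norm (v i)) * B" using *(5) B(1) by (intro mult_right_mono) auto
    finally show "norm (L (m n v)) \<le> C * B * R ^ n * (\<Prod>i<n. norm (v i))" by (simp add: ac_simps)
  qed (use * L.sums in auto)
qed

text \<open>Since \<open>L\<close> stretches by at most \<open>B\<close>, the growth rate of the
  coefficients worsens to \<open>R*B\<close> and the ball of convergence shrinks to radius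
  \<open>r/B\<close>.\<close>

lemma real_analytic_at_compose_bounded_linear:
  fixes L :: "'a::real_normed_vector \<Rightarrow> 'b::real_normed_vector" and f :: "'b \<Rightarrow> 'c::real_normed_vector"
  assumes "real_analytic_at f (L a)" "bounded_linear L"
  shows "real_analytic_at (\<lambda>x. f (L x)) a"
proof -
  interpret L: bounded_linear L by fact
  obtain m C R r where *: "0 < R" "0 < r" "0 \<le> C" "\<And>n. multilinear n (m n)"
    "\<And>n v. norm (m n v) \<le> C * R ^ n * (\<Prod>i<n. norm (v i))"
    "\<And>h. norm h < r \<Longrightarrow> (\<lambda>n. m n (\<lambda>_. h)) sums f (L a + h)"
    using real_analytic_atE[OF assms(1)] by metis
  obtain B where B: "0 < B" "\<And>x. norm (L x) \<le> norm x * B" using L.pos_bounded by blast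
  show ?thesis
  proof (rule real_analytic_atI[where m="\<lambda>n v. m n (\<lambda>i. L (v i))" and C=C and R="R*B" and r="r/B"])
    fix n
    show "multilinear n (\<lambda>v. m n (\<lambda>i. L (v i)))"
    proof (rule multilinearI)
      fix v :: "nat \<Rightarrow> 'a" and i assume "i < n"
      have "(\<lambda>j. L ((v(i := x)) j)) = (\<lambda>j. L (v j))(i := L x)" for x by auto
      then show "linear (\<lambda>x. m n (\<lambda>j. L ((v(i := x)) j)))"
        using linear_compose[OF L.linear multilinear_linear[OF *(4) \<open>i < n\<close>]] by (simp add: o_def)
    qed (rule multilinear_cong[OF *(4)], auto)
  next
    fix n v
    have "norm (m n (\<lambda>i. L (v i))) \<le> C * R ^ n * (\<Prod>i<n. norm (L (v i)))" by (rule *)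
    also have "\<dots> \<le> C * R ^ n * (B ^ n * (\<Prod>i<n. norm (v i)))"
      using B * by (intro mult_left_mono prod_norm_bound) (auto simp: ac_simps)
    finally show "norm (m n (\<lambda>i. L (v i))) \<le> C * (R*B) ^ n * (\<Prod>i<n. norm (v i))"
      by (simp add: ac_simps power_mult_distrib)
  next
    fix h :: 'a assume "norm h < r / B"
    then have "norm (L h) < r" using B(2)[of h] B(1) by (simp add: field_simps)
    then show "(\<lambda>n. m n (\<lambda>_. L h)) sums f (L (a + h))" using *(6) by (simp add: L.add)
  qed (use * B in auto)
qed

lemma real_analytic_at_const: "real_analytic_at (\<lambda>_. c) a"
proof (rule real_analytic_atI[where m="\<lambda>n _. if n = 0 then c else 0" and C="norm c" and R=1 and r=1])
  fix n
  show "multilinear n (\<lambda>_. if n = 0 then c else 0)"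
    by (rule multilinearI) (auto simp: linear_iff)
  show "(\<lambda>n. if n = 0 then c else 0) sums c" using sums_single[of 0 "\<lambda>_. c"] by simp
qed (auto intro!: prod_nonneg mult_nonneg_nonneg)

lemma real_analytic_at_bounded_linear:
  assumes "bounded_linear L"
  shows "real_analytic_at L a"
proof -
  interpret L: bounded_linear L by fact
  obtain B where B: "0 < B" "\<And>x. norm (L x) \<le> norm x * B" using L.pos_bounded by blast
  let ?m = "\<lambda>n v. if n = 0 then L a else if n = Suc 0 then L (v 0) else 0"
  show ?thesis
  proof (rule real_analytic_atI[where m="?m" and C="max B (norm (L a))" and R=1 and r=1])
    fix n :: nat
    show "multilinear n (?m n)"
      by (rule multilinearI) (auto simp: linear_iff L.add L.scaleR)
  next
    fix n :: nat and v :: "nat \<Rightarrow> 'a"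
    have "norm (v 0) * B \<le> norm (v 0) * max B (norm (L a))" by (intro mult_left_mono) auto
    then show "norm (?m n v) \<le> max B (norm (L a)) * 1 ^ n * (\<Prod>i<n. norm (v i))"
      using B(1) B(2)[of "v 0"] by (auto simp: ac_simps intro!: prod_nonneg mult_nonneg_nonneg)
  next
    fix h :: 'a
    have "(\<lambda>n. ?m n (\<lambda>_. h)) sums (\<Sum>n\<in>{0, Suc 0}. ?m n (\<lambda>_. h))"
      by (rule sums_finite) auto
    then show "(\<lambda>n. ?m n (\<lambda>_. h)) sums L (a + h)" by (simp add: L.add)
  qed auto
qed

lemma real_analytic_at_add:
  fixes f g :: "'a::real_normed_vector \<Rightarrow> 'b::real_normed_vector"
  assumes "real_analytic_at f a" "real_analytic_at g a"
  shows "real_analytic_at (\<lambda>x. f x + g x) a"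
proof -
  obtain m C R r where *: "0 < R" "0 < r" "0 \<le> C" "\<And>n. multilinear n (m n)"
    "\<And>n v. norm (m n v) \<le> C * R ^ n * (\<Prod>i<n. norm (v i))"
    "\<And>h. norm h < r \<Longrightarrow> (\<lambda>n. m n (\<lambda>_. h)) sums f (a + h)"
    using real_analytic_atE[OF assms(1)] by metis
  obtain m' C' R' r' where **: "0 < R'" "0 < r'" "0 \<le> C'" "\<And>n. multilinear n (m' n)"
    "\<And>n v. norm (m' n v) \<le> C' * R' ^ n * (\<Prod>i<n. norm (v i))"
    "\<And>h. norm h < r' \<Longrightarrow> (\<lambda>n. m' n (\<lambda>_. h)) sums g (a + h)"
    using real_analytic_atE[OF assms(2)] by metis
  show ?thesis
  proof (rule real_analytic_atI[where m="\<lambda>n v. m n v + m' n v" and C="C+C'"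
        and R="max R R'" and r="min r r'"])
    fix n
    show "multilinear n (\<lambda>v. m n v + m' n v)"
    proof (rule multilinearI)
      fix v :: "nat \<Rightarrow> 'a" and i assume "i < n"
      show "linear (\<lambda>x. m n (v(i := x)) + m' n (v(i := x)))"
        by (intro linear_compose_add multilinear_linear[OF *(4) \<open>i < n\<close>] multilinear_linear[OF **(4) \<open>i < n\<close>])
    qed (rule arg_cong2[where f=plus]; rule multilinear_cong[OF *(4)] multilinear_cong[OF **(4)]; simp)
  next
    fix n v
    have "norm (m n v + m' n v) \<le> C * R ^ n * (\<Prod>i<n. norm (v i)) + C' * R' ^ n * (\<Prod>i<n. norm (v i))"
      using *(5) **(5) norm_triangle_le add_mono by blast
    also have "\<dots> \<le> C * max R R' ^ n * (\<Prod>i<n. norm (v i)) + C' * max R R' ^ n * (\<Prod>i<n. norm (v i))"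
      using * ** by (intro add_mono mult_right_mono mult_left_mono power_mono prod_nonneg) auto
    finally show "norm (m n v + m' n v) \<le> (C + C') * max R R' ^ n * (\<Prod>i<n. norm (v i))"
      by (simp add: algebra_simps)
  qed (use * ** in \<open>auto intro: sums_add\<close>)
qed

lemma real_analytic_at_sum:
  assumes "\<And>i. i \<in> I \<Longrightarrow> real_analytic_at (f i) a"
  shows "real_analytic_at (\<lambda>x. \<Sum>i\<in>I. f i x) a"
  using assms by (induction I rule: infinite_finite_induct)
    (auto intro: real_analytic_at_const real_analytic_at_add)

lemma real_analytic_at_Pair:
  assumes "real_analytic_at f a" "real_analytic_at g a"
  shows "real_analytic_at (\<lambda>x. (f x, g x)) a"
proof -
  have "real_analytic_at (\<lambda>x. (f x, 0) + (0, g x)) a"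
    by (intro real_analytic_at_add
        real_analytic_at_bounded_linear_compose[OF assms(1), where L="\<lambda>x. (x, 0)"]
        real_analytic_at_bounded_linear_compose[OF assms(2), where L="\<lambda>x. (0, x)"]
        bounded_linear_Pair bounded_linear_ident bounded_linear_zero)
  then show ?thesis by simp
qed

text \<open>Cauchy product of the two expansions. The part of degree \<open>n\<close> sums products
  of a \<open>k\<close>-linear map in the first \<open>k\<close> arguments and an
  \<open>(n-k)\<close>-linear map in the remaining ones, hence is multilinear in all
  \<open>n\<close>.\<close>

lemma real_analytic_at_mult:
  fixes f g :: "'a::real_normed_vector \<Rightarrow> real"
  assumes "real_analytic_at f a" "real_analytic_at g a"
  shows "real_analytic_at (\<lambda>x. f x * g x) a"
proof -
  obtain m C R r where *: "0 < R" "0 < r" "0 \<le> C" "\<And>n. multilinear n (m n)"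
    "\<And>n v. norm (m n v) \<le> C * R ^ n * (\<Prod>i<n. norm (v i))"
    "\<And>h. norm h < r \<Longrightarrow> (\<lambda>n. m n (\<lambda>_. h)) sums f (a + h)"
    using real_analytic_atE[OF assms(1)] by metis
  obtain m' C' R' r' where **: "0 < R'" "0 < r'" "0 \<le> C'" "\<And>n. multilinear n (m' n)"
    "\<And>n v. norm (m' n v) \<le> C' * R' ^ n * (\<Prod>i<n. norm (v i))"
    "\<And>h. norm h < r' \<Longrightarrow> (\<lambda>n. m' n (\<lambda>_. h)) sums g (a + h)"
    using real_analytic_atE[OF assms(2)] by metis
  let ?M = "\<lambda>n v. \<Sum>k\<le>n. m k v * m' (n - k) (\<lambda>i. v (i + k))"
  define R'' where "R'' = max R R'"
  have R'': "R \<le> R''" "R' \<le> R''" "0 < R''" using * ** by (auto simp: R''_def)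
  \<comment> \<open>Below \<open>1 / (2 * R'')\<close> both series are dominated by geometric series
    of ratio 1/2, which gives the absolute convergence required by the Cauchy product.\<close>
  define \<delta> where "\<delta> = Min {r, r', 1 / (2 * R'')}"
  have \<delta>: "0 < \<delta>" "\<delta> \<le> r" "\<delta> \<le> r'" "\<delta> \<le> 1 / (2 * R'')" using * ** R'' by (auto simp: \<delta>_def)
  show ?thesis
  proof (rule real_analytic_atI[where m="?M" and C="C*C'" and R="2 * R''" and r=\<delta>])
    fix n
    show "multilinear n (?M n)"
    proof (rule multilinearI)
      fix v w :: "nat \<Rightarrow> 'a" assume vw: "\<And>i. i < n \<Longrightarrow> v i = w i"
      show "?M n v = ?M n w"
      proof (rule sum.cong[OF refl])
        fix k assume "k \<in> {..n}"
        then show "m k v * m' (n - k) (\<lambda>i. v (i + k)) = m k w * m' (n - k) (\<lambda>i. w (i + k))"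
          using vw multilinear_cong[OF *(4), of k v w]
            multilinear_cong[OF **(4), of "n - k" "\<lambda>i. v (i + k)" "\<lambda>i. w (i + k)"] by simp
      qed
    next
      fix v :: "nat \<Rightarrow> 'a" and i assume i: "i < n"
      show "linear (\<lambda>x. ?M n (v(i := x)))"
      proof (rule linear_compose_sum, rule ballI)
        fix k assume k: "k \<in> {..n}"
        show "linear (\<lambda>x. m k (v(i := x)) * m' (n - k) (\<lambda>j. (v(i := x)) (j + k)))"
        proof (cases "i < k")
          case True
          then have "(\<lambda>j. (v(i := x)) (j + k)) = (\<lambda>j. v (j + k))" for x by auto
          then show ?thesis
            using multilinear_linear[OF *(4) True, of v] by (auto simp: linear_iff algebra_simps)
        next
          case False
          then have "(\<lambda>j. (v(i := x)) (j + k)) = (\<lambda>j. v (j + k))(i - k := x)" for x by (force simp: fun_eq_iff)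
          moreover have "m k (v(i := x)) = m k v" for x
            by (rule multilinear_cong[OF *(4)]) (use False in auto)
          moreover have "i - k < n - k" using False i by auto
          ultimately show ?thesis
            using multilinear_linear[OF **(4), of "i - k" "n - k" "\<lambda>j. v (j + k)"]
            by (simp add: linear_iff algebra_simps)
        qed
      qed
    qed
  next
    fix n and v :: "nat \<Rightarrow> 'a"
    have "norm (?M n v) \<le> (\<Sum>k\<le>n. C * C' * R'' ^ n * (\<Prod>i<n. norm (v i)))"
    proof (rule sum_norm_le)
      fix k assume k: "k \<in> {..n}"
      have p: "(\<Prod>i<n. norm (v i)) = (\<Prod>i<k. norm (v i)) * (\<Prod>i<n-k. norm (v (i + k)))"
      proof -
        have "{..<n} = {..<k} \<union> {k..<n}" using k by auto
        then have "(\<Prod>i<n. norm (v i)) = (\<Prod>i<k. norm (v i)) * (\<Prod>i=k..<n. norm (v i))"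
          by (simp add: prod.union_disjoint ivl_disj_int)
        also have "(\<Prod>i=k..<n. norm (v i)) = (\<Prod>i<n-k. norm (v (i + k)))"
          using k by (intro prod.reindex_bij_witness[of _ "\<lambda>i. i + k" "\<lambda>i. i - k"]) auto
        finally show ?thesis .
      qed
      have "norm (m k v * m' (n - k) (\<lambda>i. v (i + k)))
          \<le> (C * R ^ k * (\<Prod>i<k. norm (v i))) * (C' * R' ^ (n-k) * (\<Prod>i<n-k. norm (v (i + k))))"
        unfolding norm_mult using * ** by (intro mult_mono) (auto intro!: prod_nonneg mult_nonneg_nonneg)
      also have "\<dots> \<le> (C * R'' ^ k * (\<Prod>i<k. norm (v i))) * (C' * R'' ^ (n-k) * (\<Prod>i<n-k. norm (v (i + k))))"
        using * ** R'' by (intro mult_mono power_mono) (auto intro!: prod_nonneg mult_nonneg_nonneg)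
      also have "\<dots> = C * C' * (R'' ^ k * R'' ^ (n-k)) * (\<Prod>i<n. norm (v i))" unfolding p by simp
      also have "R'' ^ k * R'' ^ (n-k) = R'' ^ n" using k by (simp flip: power_add)
      finally show "norm (m k v * m' (n - k) (\<lambda>i. v (i + k))) \<le> C * C' * R'' ^ n * (\<Prod>i<n. norm (v i))" .
    qed
    also have "\<dots> = (C * C' * R'' ^ n * (\<Prod>i<n. norm (v i))) * real (n + 1)" by simp
    \<comment> \<open>The number \<open>n + 1\<close> of summands is absorbed by doubling the
      geometric rate.\<close>
    also have "\<dots> \<le> (C * C' * R'' ^ n * (\<Prod>i<n. norm (v i))) * 2 ^ n"
    proof -
      have "n + 1 \<le> 2 ^ n" using less_exp[of n] by linarith
      then have "real (n + 1) \<le> 2 ^ n" by (metis of_nat_le_iff of_nat_numeral of_nat_power)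
      then show ?thesis using * ** R'' by (intro mult_left_mono) (auto intro!: prod_nonneg mult_nonneg_nonneg)
    qed
    finally show "norm (?M n v) \<le> C * C' * (2 * R'') ^ n * (\<Prod>i<n. norm (v i))"
      by (simp add: power_mult_distrib algebra_simps)
  next
    fix h :: 'a assume h: "norm h < \<delta>"
    have geo: "summable (\<lambda>n. norm (p n (\<lambda>_. h)))"
      if "\<And>n v. norm (p n v) \<le> c * \<rho> ^ n * (\<Prod>i<n. norm (v i))" "0 \<le> \<rho>" "\<rho> \<le> R''" "0 \<le> c"
      for p :: "nat \<Rightarrow> (nat \<Rightarrow> 'a) \<Rightarrow> real" and c \<rho>
    proof (rule summable_comparison_test[of _ "\<lambda>n. c * (1/2) ^ n"], intro exI allI impI)
      fix n
      have "\<rho> * norm h \<le> R'' * (1 / (2 * R''))" using that h \<delta> by (intro mult_mono) auto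
      then have le: "\<rho> * norm h \<le> 1/2" using R'' by simp
      have "norm (p n (\<lambda>_. h)) \<le> c * (\<rho> * norm h) ^ n" using that(1)[of n "\<lambda>_. h"]
        by (simp add: power_mult_distrib ac_simps)
      also have "\<dots> \<le> c * (1/2) ^ n" using le that by (intro mult_left_mono power_mono) auto
      finally show "norm (norm (p n (\<lambda>_. h))) \<le> c * (1/2) ^ n" by simp
    qed (auto intro!: summable_mult summable_geometric)
    have "(\<lambda>n. \<Sum>k\<le>n. m k (\<lambda>_. h) * m' (n - k) (\<lambda>_. h)) sums
        ((\<Sum>n. m n (\<lambda>_. h)) * (\<Sum>n. m' n (\<lambda>_. h)))"
      by (rule Cauchy_product_sums[OF geo[OF *(5)] geo[OF **(5)]]) (use * ** R'' in auto)
    moreover have "(\<Sum>n. m n (\<lambda>_. h)) = f (a + h)" "(\<Sum>n. m' n (\<lambda>_. h)) = g (a + h)"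
      using *(6) **(6) h \<delta> by (auto simp: sums_iff)
    ultimately show "(\<lambda>n. ?M n (\<lambda>_. h)) sums (f (a + h) * g (a + h))" by simp
  qed (use \<delta> R'' in auto)
qed

text \<open>Geometric series of \<open>inverse (x + h)\<close> in the ratio \<open>- h / x\<close>,
  convergent for \<open>|h| < |x|\<close>. The multilinear form of degree \<open>n\<close> takes one
  factor from each argument.\<close>

lemma real_analytic_at_inverse: "x \<noteq> 0 \<Longrightarrow> real_analytic_at inverse (x::real)"
proof (rule real_analytic_atI[where m="\<lambda>n v. inverse x * (\<Prod>i<n. - inverse x * v i)"
      and C="norm (inverse x)" and R="norm (inverse x)" and r="norm x"])
  fix n assume "x \<noteq> 0"
  show "multilinear n (\<lambda>v. inverse x * (\<Prod>i<n. - inverse x * v i))"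
  proof (rule multilinearI)
    fix v :: "nat \<Rightarrow> real" and i assume i: "i < n"
    have "(\<Prod>j<n. - inverse x * (v(i := y)) j)
      = (- inverse x * y) * (\<Prod>j\<in>{..<n} - {i}. - inverse x * v j)" for y
      using i by (subst prod.remove[of _ i]) (auto intro!: prod.cong)
    then show "linear (\<lambda>y. inverse x * (\<Prod>j<n. - inverse x * (v(i := y)) j))"
      by (simp add: linear_iff algebra_simps)
  qed auto
next
  fix n v
  show "norm (inverse x * (\<Prod>i<n. - inverse x * v i))
    \<le> norm (inverse x) * norm (inverse x) ^ n * (\<Prod>i<n. norm (v i))"
    unfolding prod.distrib norm_mult prod_norm[symmetric] by simp
next
  fix h :: real assume x: "x \<noteq> 0" and h: "norm h < norm x"
  have "norm (- inverse x * h) < 1" using x h by (simp add: norm_mult field_simps abs_mult)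
  from sums_mult[OF geometric_sums[OF this], of "inverse x"] x
  have "(\<lambda>n. inverse x * (- inverse x * h) ^ n) sums (inverse x * (1 / (1 + inverse x * h)))" by simp
  also have "inverse x * (1 / (1 + inverse x * h)) = inverse (x + h)"
    using x by (simp add: field_simps)
  finally show "(\<lambda>n. inverse x * (\<Prod>i<n. - inverse x * h)) sums inverse (x + h)" by simp
qed auto

section \<open>Strict differentiability of analytic maps\<close>

text \<open>Both points of the difference move here, unlike in the Frechet derivative at
  \<open>a\<close>. Estimates in the group need this: they compare two products neither of which is
  the product of the base points.\<close>

definition strict_derivative ::
  "('a::real_normed_vector \<Rightarrow> 'b::real_normed_vector) \<Rightarrow> ('a \<Rightarrow> 'b) \<Rightarrow> 'a \<Rightarrow> bool" where
  "strict_derivative f f' a \<longleftrightarrow> bounded_linear f' \<and>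
     (\<forall>e>0. \<exists>d>0. \<forall>x\<in>ball a d. \<forall>y\<in>ball a d. norm (f x - f y - f' (x - y)) \<le> e * norm (x - y))"

text \<open>The arguments are changed from \<open>q\<close> to \<open>p\<close> one at a time; each
  of the \<open>n\<close> steps costs one factor \<open>norm (p - q)\<close> and
  \<open>n - 1\<close> factors of size at most \<open>t\<close>. At \<open>n = 0\<close> the factor
  \<open>real n\<close> takes care of the truncated \<open>n - 1\<close>.\<close>

lemma multilinear_diag_diff:
  fixes m :: "(nat \<Rightarrow> 'a::real_normed_vector) \<Rightarrow> 'b::real_normed_vector"
  assumes "multilinear n m" "\<And>v. norm (m v) \<le> K * (\<Prod>i<n. norm (v i))" "0 \<le> K"
    "norm p \<le> t" "norm q \<le> t"
  shows "norm (m (\<lambda>_. p) - m (\<lambda>_. q)) \<le> real n * K * t ^ (n - 1) * norm (p - q)"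
proof -
  define F where "F = (\<lambda>k. m (\<lambda>i. if i < k then p else q))"
  have "0 \<le> t" using assms(4) norm_ge_zero order_trans by blast
  have step: "norm (F (Suc k) - F k) \<le> K * t ^ (n - 1) * norm (p - q)" if k: "k < n" for k
  proof -
    let ?v = "\<lambda>i. if i < k then p else q"
    have "F (Suc k) = m (?v(k := p))" "F k = m (?v(k := q))"
      unfolding F_def by (auto intro!: arg_cong[where f=m])
    then have "F (Suc k) - F k = m (?v(k := p - q))"
      using linear_diff[OF multilinear_linear[OF assms(1) k, of ?v]] by simp
    also have "norm \<dots> \<le> K * (\<Prod>i<n. norm ((?v(k := p - q)) i))" by (rule assms)
    also have "(\<Prod>i<n. norm ((?v(k := p - q)) i)) = norm (p - q) * (\<Prod>i\<in>{..<n}-{k}. norm (?v i))"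
      using k by (subst prod.remove[of _ k]) (auto intro!: prod.cong)
    finally have 1: "norm (F (Suc k) - F k) \<le> K * (norm (p - q) * (\<Prod>i\<in>{..<n}-{k}. norm (?v i)))" .
    have "(\<Prod>i\<in>{..<n}-{k}. norm (?v i)) \<le> (\<Prod>i\<in>{..<n}-{k}. t)"
      by (rule prod_mono) (use assms in auto)
    also have "\<dots> = t ^ (n - 1)" using k by simp
    finally have "K * (norm (p - q) * (\<Prod>i\<in>{..<n}-{k}. norm (?v i))) \<le> K * (norm (p - q) * t ^ (n - 1))"
      using \<open>0 \<le> K\<close> by (intro mult_left_mono) auto
    with 1 show ?thesis by (simp add: ac_simps)
  qed
  have "F n = m (\<lambda>_. p)" unfolding F_def by (rule multilinear_cong[OF assms(1)]) auto
  moreover have "F 0 = m (\<lambda>_. q)" by (simp add: F_def)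
  ultimately have "m (\<lambda>_. p) - m (\<lambda>_. q) = (\<Sum>k<n. F (Suc k) - F k)"
    by (simp add: sum_lessThan_telescope)
  also have "norm \<dots> \<le> (\<Sum>k<n. K * t ^ (n - 1) * norm (p - q))"
    by (rule sum_norm_le) (use step in auto)
  finally show ?thesis by (simp add: ac_simps)
qed

text \<open>The derivative is the linear term of the series. In a difference the constant terms
  cancel, and the terms of degree at least 2 contribute at most a multiple of
  \<open>t * norm (p - q)\<close> on the ball of radius \<open>t\<close>, which is small relative to
  \<open>norm (p - q)\<close>.\<close>

lemma real_analytic_at_imp_strict_derivative:
  fixes f :: "'a::real_normed_vector \<Rightarrow> 'b::banach"
  assumes "real_analytic_at f a"
  obtains f' where "strict_derivative f f' a"
proof -
  obtain m C R r where *: "0 < R" "0 < r" "0 \<le> C" "\<And>n. multilinear n (m n)"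
    "\<And>n v. norm (m n v) \<le> C * R ^ n * (\<Prod>i<n. norm (v i))"
    "\<And>h. norm h < r \<Longrightarrow> (\<lambda>n. m n (\<lambda>_. h)) sums f (a + h)"
    using real_analytic_atE[OF assms(1)] by metis
  define f' where "f' = (\<lambda>h. m 1 (\<lambda>_. h))"
  have f': "bounded_linear f'"
  proof (rule bounded_linear_intro)
    have eq: "f' h = m 1 ((\<lambda>_. 0)(0 := h))" for h
      unfolding f'_def by (rule multilinear_cong[OF *(4)]) auto
    have "linear f'" unfolding eq by (rule multilinear_linear[OF *(4)]) auto
    then show "f' (x + y) = f' x + f' y" "f' (r *\<^sub>R x) = r *\<^sub>R f' x" for x y r
      by (auto simp: linear_iff)
    show "norm (f' x) \<le> norm x * (C * R)" for x
      using *(5)[of 1 "\<lambda>_. x"] by (simp add: f'_def ac_simps)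
  qed
  \<comment> \<open>The degree \<open>n + 2\<close> contributes the factor \<open>n + 2\<close> by
    the telescoping estimate, and \<open>(1/2) ^ n\<close> because
    \<open>R * t \<le> 1/2\<close>.\<close>
  define S where "S = (\<Sum>n. real (n + 2) * (1/2) ^ n)"
  have summ: "summable (\<lambda>n. real (n + 2) * (1/2::real) ^ n)"
  proof -
    have "summable (\<lambda>n. real n * (1/2::real) ^ n)"
      by (rule summable_ratio_test[where c="3/4" and N=2]) (auto simp: field_simps)
    moreover have "summable (\<lambda>n. 2 * (1/2::real) ^ n)" by (intro summable_mult summable_geometric) auto
    ultimately have "summable (\<lambda>n. real n * (1/2::real) ^ n + 2 * (1/2::real) ^ n)" by (rule summable_add)
    then show ?thesis by (simp add: algebra_simps)
  qed
  have "0 \<le> S" unfolding S_def by (rule suminf_nonneg[OF summ]) auto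
  have key: "norm (f (a + p) - f (a + q) - f' (p - q)) \<le> C * R^2 * t * S * norm (p - q)"
    if t: "norm p \<le> t" "norm q \<le> t" "t < r" "t \<le> 1 / (2 * R)" for p q t
  proof -
    have t0: "0 \<le> t" using t norm_ge_zero order_trans by blast
    let ?c = "\<lambda>n. m n (\<lambda>_. p) - m n (\<lambda>_. q)"
    have "?c sums (f (a + p) - f (a + q))" using *(6) t by (intro sums_diff) auto
    then have "(\<lambda>n. ?c (n + 2)) sums (f (a + p) - f (a + q) - (\<Sum>n<2. ?c n))"
      by (rule sums_split_initial_segment)
    also have "(\<Sum>n<2. ?c n) = f' (p - q)"
    proof -
      have "m 0 (\<lambda>_. p) = m 0 (\<lambda>_. q)" by (rule multilinear_cong[OF *(4)]) auto
      then show ?thesis using bounded_linear.linear[OF f', THEN linear_diff, of p q]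
        by (simp add: numeral_2_eq_2 f'_def)
    qed
    finally have s: "(\<lambda>n. ?c (n + 2)) sums (f (a + p) - f (a + q) - f' (p - q))" .
    let ?B = "\<lambda>n. (C * R^2 * t * norm (p - q)) * (real (n + 2) * (1/2) ^ n)"
    have le: "norm (?c (n + 2)) \<le> ?B n" for n
    proof -
      have "norm (?c (n + 2)) \<le> real (n + 2) * (C * R ^ (n + 2)) * t ^ (n + 2 - 1) * norm (p - q)"
        by (rule multilinear_diag_diff[OF *(4) *(5)]) (use * t in auto)
      also have "\<dots> = (C * R^2 * t * norm (p - q)) * (real (n + 2) * (R * t) ^ n)"
        by (simp add: power_mult_distrib power_add ac_simps power2_eq_square)
      also have "\<dots> \<le> ?B n"
      proof -
        have "R * t \<le> 1/2" using t(4) *(1) by (simp add: field_simps)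
        then show ?thesis using * t0 by (intro mult_left_mono power_mono) auto
      qed
      finally show ?thesis .
    qed
    have "norm (\<Sum>n. ?c (n + 2)) \<le> (\<Sum>n. ?B n)"
      by (rule norm_suminf_le[OF le summable_mult[OF summ]])
    also have "\<dots> = C * R^2 * t * norm (p - q) * S"
      unfolding S_def by (rule suminf_mult[OF summ])
    finally show ?thesis using s by (simp add: sums_iff ac_simps)
  qed
  have "strict_derivative f f' a" unfolding strict_derivative_def
  proof (intro conjI f' allI impI)
    fix e :: real assume e: "e > 0"
    \<comment> \<open>The last bound makes \<open>C * R^2 * t * S \<le> e\<close>; the added 1 keeps
      the denominator positive when \<open>C * R^2 * S = 0\<close>.\<close>
    define t where "t = min (r / 2) (min (1 / (2 * R)) (e / (C * R^2 * S + 1)))"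
    have pos: "0 < C * R^2 * S + 1" using * \<open>0 \<le> S\<close> by (intro add_nonneg_pos mult_nonneg_nonneg) auto
    have t: "0 < t" "t < r" "t \<le> 1 / (2 * R)" "t \<le> e / (C * R^2 * S + 1)"
      using * e pos by (simp_all add: t_def min_less_iff_disj min_le_iff_disj)
    have "C * R^2 * t * S \<le> t * (C * R^2 * S + 1)" using t by (simp add: algebra_simps)
    also have "\<dots> \<le> e" using t(4) pos by (simp add: field_simps)
    finally have le: "C * R^2 * t * S \<le> e" .
    show "\<exists>d>0. \<forall>x\<in>ball a d. \<forall>y\<in>ball a d. norm (f x - f y - f' (x - y)) \<le> e * norm (x - y)"
    proof (intro exI[of _ t] conjI ballI t)
      fix x y assume "x \<in> ball a t" "y \<in> ball a t"
      then have "norm (f (a + (x - a)) - f (a + (y - a)) - f' ((x - a) - (y - a)))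
        \<le> C * R^2 * t * S * norm ((x - a) - (y - a))"
        by (intro key) (use t in \<open>auto simp: dist_norm norm_minus_commute\<close>)
      also have "\<dots> \<le> e * norm ((x - a) - (y - a))" using le by (rule mult_right_mono) auto
      finally show "norm (f x - f y - f' (x - y)) \<le> e * norm (x - y)" by simp
    qed
  qed
  then show ?thesis using that by blast
qed

lemma strict_derivative_imp_has_derivative:
  assumes "strict_derivative f f' a"
  shows "(f has_derivative f') (at a)"
  unfolding has_derivative_at_alt
proof (intro conjI allI impI)
  show "bounded_linear f'" using assms by (simp add: strict_derivative_def)
  fix e :: real assume "0 < e"
  then obtain d where "d > 0" and
    d: "\<And>x y. x \<in> ball a d \<Longrightarrow> y \<in> ball a d \<Longrightarrow> norm (f x - f y - f' (x - y)) \<le> e * norm (x - y)"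
    using assms unfolding strict_derivative_def by metis
  then show "\<exists>d>0. \<forall>y. norm (y - a) < d \<longrightarrow> norm (f y - f a - f' (y - a)) \<le> e * norm (y - a)"
    by (intro exI[of _ d]) (auto simp: dist_norm norm_minus_commute)
qed

lemma real_analytic_at_imp_isCont:
  fixes f :: "'a::real_normed_vector \<Rightarrow> 'b::banach"
  assumes "real_analytic_at f a" shows "isCont f a"
  by (meson assms has_derivative_continuous real_analytic_at_imp_strict_derivative
      strict_derivative_imp_has_derivative)

section \<open>Charts that are restrictions of linear maps\<close>

text \<open>Tailored to matrix groups whose charts read off some entries: such a chart restricts a
  bounded linear map, and its inverse is analytic as a map into the ambient space. Analyticity on
  the manifold then reduces to analyticity of maps between Banach spaces.\<close>

definition submanifold :: "'m::banach set \<Rightarrow> ('m, 'e::banach) manifold \<Rightarrow> bool" where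
  "submanifold S M \<longleftrightarrow> mtop M = top_of_set S \<and> (\<Union>(U, \<phi>)\<in>atlas M. U) = S \<and>
     (\<forall>(U, \<phi>)\<in>atlas M. bounded_linear \<phi> \<and> openin (top_of_set S) U \<and> open (\<phi> ` U) \<and>
        (\<exists>\<iota>. (\<forall>A\<in>U. \<iota> (\<phi> A) = A) \<and> (\<forall>p\<in>\<phi> ` U. real_analytic_at \<iota> p)))"

lemma submanifoldE:
  assumes "submanifold S M" "(U, \<phi>) \<in> atlas M"
  obtains \<iota> where "bounded_linear \<phi>" "openin (top_of_set S) U" "open (\<phi> ` U)" "U \<subseteq> S"
    "\<And>A. A \<in> U \<Longrightarrow> \<iota> (\<phi> A) = A" "\<And>p. p \<in> \<phi> ` U \<Longrightarrow> real_analytic_at \<iota> p"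
    "inj_on \<phi> U" "\<And>p. p \<in> \<phi> ` U \<Longrightarrow> the_inv_into U \<phi> p = \<iota> p" "mtop M = top_of_set S"
proof -
  obtain \<iota> where *: "bounded_linear \<phi>" "openin (top_of_set S) U" "open (\<phi> ` U)"
    "\<And>A. A \<in> U \<Longrightarrow> \<iota> (\<phi> A) = A" "\<And>p. p \<in> \<phi> ` U \<Longrightarrow> real_analytic_at \<iota> p" "mtop M = top_of_set S"
    using assms unfolding submanifold_def by fast
  have inj: "inj_on \<phi> U" using *(4) by (metis inj_onI)
  then have "the_inv_into U \<phi> p = \<iota> p" if "p \<in> \<phi> ` U" for p
    using that *(4) by (auto simp: the_inv_into_f_f)
  with * inj show ?thesis using that openin_imp_subset[OF *(2)] by blast
qed

text \<open>In coordinates \<open>f\<close> is \<open>\<psi> \<circ> g \<circ> \<iota>\<close> with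
  \<open>\<psi>\<close> linear. Hypothesis \<open>an\<close> asks that composing with
  \<open>g\<close> preserves analyticity; for polynomial \<open>g\<close> this follows from sums and
  products, without substituting one power series into another. The ambient map \<open>g\<close> has
  to agree with \<open>f\<close> only on \<open>S\<close>, as the adjugate does with group
  inversion.\<close>

lemma submanifold_analytic_map:
  fixes M :: "('m::banach, 'e::banach) manifold"
    and N :: "('n::banach, 'f::banach) manifold"
  assumes M: "submanifold S M" and N: "submanifold T N"
    and maps: "\<And>A. A \<in> S \<Longrightarrow> g A \<in> T"
    and an: "\<And>\<iota> (p::'e). real_analytic_at \<iota> p \<Longrightarrow> real_analytic_at (\<lambda>x. g (\<iota> x)) p"
    and cont: "continuous_on S g"
    and eq: "\<And>A. A \<in> S \<Longrightarrow> f A = g A"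
  shows "analytic_map M N f"
  unfolding analytic_map_def
proof (intro conjI ballI)
  have "continuous_on S f" using cont eq by (metis continuous_on_cong)
  then show "continuous_map (mtop M) (mtop N) f"
    using M N maps eq unfolding submanifold_def by (auto simp: continuous_map_in_subtopology)
next
  have "real_analytic_on (\<psi> \<circ> f \<circ> the_inv_into U \<phi>) (\<phi> ` {x \<in> U. f x \<in> V})"
    if c: "(U, \<phi>) \<in> atlas M" and d: "(V, \<psi>) \<in> atlas N" for U \<phi> V \<psi>
  proof -
  obtain \<iota> where U: "bounded_linear \<phi>" "openin (top_of_set S) U" "open (\<phi> ` U)" "U \<subseteq> S"
    "\<And>A. A \<in> U \<Longrightarrow> \<iota> (\<phi> A) = A" "\<And>p. p \<in> \<phi> ` U \<Longrightarrow> real_analytic_at \<iota> p"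
    "\<And>p. p \<in> \<phi> ` U \<Longrightarrow> the_inv_into U \<phi> p = \<iota> p"
    using submanifoldE[OF M c] by metis
  have V: "bounded_linear \<psi>" "openin (top_of_set T) V" using submanifoldE[OF N d] by metis+
  obtain W where W: "open W" "V = T \<inter> W" using V(2) by (auto simp: openin_open)
  have \<iota>: "\<iota> p \<in> U" if "p \<in> \<phi> ` U" for p using that U(5) by auto
  \<comment> \<open>Written through the preimage of the open set \<open>W\<close> under the
    continuous \<open>g \<circ> \<iota>\<close>, the coordinate domain is seen to be open.\<close>
  have img: "\<phi> ` {x\<in>U. f x \<in> V} = {p \<in> \<phi> ` U. g (\<iota> p) \<in> W}"
  proof -
    have "f x \<in> V \<longleftrightarrow> g x \<in> W" if "x \<in> U" for x
      using that U(4) eq[of x] maps[of x] W by auto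
    then show ?thesis using U(5) by auto
  qed
  have an': "real_analytic_at (\<lambda>p. g (\<iota> p)) p" if "p \<in> \<phi> ` U" for p using an U(6) that by blast
  have "continuous_on (\<phi> ` U) (\<lambda>p. g (\<iota> p))"
    using an' real_analytic_at_imp_isCont continuous_at_imp_continuous_on by blast
  then have op: "open (\<phi> ` {x\<in>U. f x \<in> V})"
    using continuous_open_preimage[OF _ U(3) W(1)] unfolding img vimage_def by (simp add: Int_def)
  have "real_analytic_at (\<psi> \<circ> f \<circ> the_inv_into U \<phi>) p" if "p \<in> \<phi> ` U" for p
  proof (rule real_analytic_at_transform[OF _ U(3) that])
    show "real_analytic_at (\<lambda>p. \<psi> (g (\<iota> p))) p"
      by (rule real_analytic_at_bounded_linear_compose[OF an'[OF that] V(1)])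
    fix q assume "q \<in> \<phi> ` U"
    then show "\<psi> (g (\<iota> q)) = (\<psi> \<circ> f \<circ> the_inv_into U \<phi>) q"
      using U(7) U(4) \<iota> eq by (simp add: subset_iff)
  qed
  then show ?thesis using op unfolding real_analytic_on_def by auto
  qed
  then show "\<And>c. c \<in> atlas M \<Longrightarrow> case c of (U, \<phi>) \<Rightarrow> \<forall>(V, \<psi>)\<in>atlas N.
      real_analytic_on (\<psi> \<circ> f \<circ> the_inv_into U \<phi>) (\<phi> ` {x \<in> U. f x \<in> V})" by auto
qed

lemma submanifold_imp_analytic_manifold:
  assumes "submanifold S M"
  shows "analytic_manifold M"
  unfolding analytic_manifold_def
proof (intro conjI ballI)
  fix c assume "c \<in> atlas M"
  then obtain U \<phi> where c: "c = (U, \<phi>)" "(U, \<phi>) \<in> atlas M" by (metis surj_pair)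
  obtain \<iota> where U: "bounded_linear \<phi>" "openin (top_of_set S) U" "open (\<phi> ` U)" "U \<subseteq> S"
    "\<And>A. A \<in> U \<Longrightarrow> \<iota> (\<phi> A) = A" "\<And>p. p \<in> \<phi> ` U \<Longrightarrow> real_analytic_at \<iota> p"
    "mtop M = top_of_set S"
    using submanifoldE[OF assms c(2)] by metis
  have "continuous_on (\<phi> ` U) \<iota>"
    using U(6) real_analytic_at_imp_isCont continuous_at_imp_continuous_on by blast
  then have "homeomorphic_maps (top_of_set U) (top_of_set (\<phi> ` U)) \<phi> \<iota>"
    using U by (auto simp: homeomorphic_maps_def continuous_map_in_subtopology
        bounded_linear.linear linear_continuous_on)
  moreover have "subtopology (mtop M) U = top_of_set U"
    using U by (simp add: subtopology_subtopology Int_absorb1)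
  ultimately show "case c of (U, \<phi>) \<Rightarrow> chart (mtop M) U \<phi>"
    unfolding c chart_def prod.case using U by (auto simp: homeomorphic_map_maps)
next
  \<comment> \<open>Transition maps are the coordinate expressions of the identity.\<close>
  have "analytic_map M M id"
    by (rule submanifold_analytic_map[OF assms assms]) auto
  then have *: "\<forall>(U, \<phi>)\<in>atlas M. \<forall>(V, \<psi>)\<in>atlas M.
      real_analytic_on (\<psi> \<circ> the_inv_into U \<phi>) (\<phi> ` {x\<in>U. x \<in> V})"
    by (simp add: analytic_map_def)
  fix c assume "c \<in> atlas M"
  with * show "case c of (U, \<phi>) \<Rightarrow> \<forall>(V, \<psi>)\<in>atlas M.
      real_analytic_on (\<psi> \<circ> the_inv_into U \<phi>) (\<phi> ` (U \<inter> V))"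
    by (simp add: Int_def)
qed (use assms in \<open>simp add: submanifold_def\<close>)

lemma submanifold_prod:
  assumes M: "submanifold S M" and N: "submanifold T N"
  shows "submanifold (S \<times> T) (prod_manifold M N)"
  unfolding submanifold_def
proof (intro conjI ballI)
  show "mtop (prod_manifold M N) = top_of_set (S \<times> T)"
    using M N by (simp add: prod_manifold_def submanifold_def)
  have "(\<Union>(U, \<phi>)\<in>atlas (prod_manifold M N). U)
      = (\<Union>(U, \<phi>)\<in>atlas M. U) \<times> (\<Union>(U, \<phi>)\<in>atlas N. U)" (is "?L = ?R")
  proof (intro equalityI subsetI)
    fix z assume "z \<in> ?L"
    then obtain U \<phi> V \<psi> where "(U, \<phi>) \<in> atlas M" "(V, \<psi>) \<in> atlas N" "z \<in> U \<times> V"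
      by (auto simp: prod_manifold_def)
    then show "z \<in> ?R" by blast
  next
    fix z assume "z \<in> ?R"
    then obtain U \<phi> V \<psi> where *: "(U, \<phi>) \<in> atlas M" "(V, \<psi>) \<in> atlas N" "z \<in> U \<times> V"
      by blast
    then have "(U \<times> V, map_prod \<phi> \<psi>) \<in> atlas (prod_manifold M N)"
      unfolding prod_manifold_def by auto
    then show "z \<in> ?L" using *(3) by blast
  qed
  then show "(\<Union>(U, \<phi>)\<in>atlas (prod_manifold M N). U) = S \<times> T"
    using M N by (simp add: submanifold_def)
next
  fix c assume "c \<in> atlas (prod_manifold M N)"
  then obtain U \<phi> V \<psi> where c: "c = (U \<times> V, map_prod \<phi> \<psi>)" "(U, \<phi>) \<in> atlas M" "(V, \<psi>) \<in> atlas N"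
    by (auto simp: prod_manifold_def)
  obtain \<iota> where U: "bounded_linear \<phi>" "openin (top_of_set S) U" "open (\<phi> ` U)"
    "\<And>A. A \<in> U \<Longrightarrow> \<iota> (\<phi> A) = A" "\<And>p. p \<in> \<phi> ` U \<Longrightarrow> real_analytic_at \<iota> p"
    using submanifoldE[OF M c(2)] by metis
  obtain \<kappa> where V: "bounded_linear \<psi>" "openin (top_of_set T) V" "open (\<psi> ` V)"
    "\<And>A. A \<in> V \<Longrightarrow> \<kappa> (\<psi> A) = A" "\<And>p. p \<in> \<psi> ` V \<Longrightarrow> real_analytic_at \<kappa> p"
    using submanifoldE[OF N c(3)] by metis
  have img: "map_prod \<phi> \<psi> ` (U \<times> V) = \<phi> ` U \<times> \<psi> ` V" by auto
  have "bounded_linear (map_prod \<phi> \<psi>)"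
    unfolding map_prod_def case_prod_unfold
    by (intro bounded_linear_Pair bounded_linear_compose[OF U(1)] bounded_linear_compose[OF V(1)]
        bounded_linear_fst bounded_linear_snd)
  moreover have "real_analytic_at (\<lambda>x. (\<iota> (fst x), \<kappa> (snd x))) p" if "p \<in> \<phi> ` U \<times> \<psi> ` V" for p
    using that U(5) V(5)
    by (intro real_analytic_at_Pair real_analytic_at_compose_bounded_linear[where L=fst]
        real_analytic_at_compose_bounded_linear[where L=snd] bounded_linear_fst bounded_linear_snd) auto
  moreover have "openin (top_of_set (S \<times> T)) (U \<times> V)" using U V by (simp add: openin_Times)
  moreover have "open (\<phi> ` U \<times> \<psi> ` V)" using U V by (simp add: open_Times)
  ultimately show "case c of (U, \<phi>) \<Rightarrow> bounded_linear \<phi> \<and> openin (top_of_set (S \<times> T)) U \<and>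
      open (\<phi> ` U) \<and> (\<exists>\<iota>. (\<forall>A\<in>U. \<iota> (\<phi> A) = A) \<and> (\<forall>p\<in>\<phi> ` U. real_analytic_at \<iota> p))"
    unfolding c prod.case img using U(4) V(4)
    by (intro conjI exI[of _ "\<lambda>x. (\<iota> (fst x), \<kappa> (snd x))"]) auto
qed

section \<open>The matrix groups\<close>

definition mat2 :: "real \<Rightarrow> real \<Rightarrow> real \<Rightarrow> real \<Rightarrow> real^2^2" where
  "mat2 a b c d = vector [vector [a, b], vector [c, d]]"

lemma mat2_nth [simp]:
  "mat2 a b c d $ 1 $ 1 = a" "mat2 a b c d $ 1 $ 2 = b"
  "mat2 a b c d $ 2 $ 1 = c" "mat2 a b c d $ 2 $ 2 = d"
  by (simp_all add: mat2_def)

lemma mat2_eqI: "A$1$1 = B$1$1 \<Longrightarrow> A$1$2 = B$1$2 \<Longrightarrow> A$2$1 = B$2$1 \<Longrightarrow> A$2$2 = B$2$2 \<Longrightarrow> A = B"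
  for A B :: "real^2^2"
  by (simp add: vec_eq_iff forall_2)

lemma matrix_mult_2_nth: "((A :: real^2^2) ** B) $ i $ j = A$i$1 * B$1$j + A$i$2 * B$2$j"
  by (simp add: matrix_matrix_mult_def sum_2)

lemma mat2_mult:
  "mat2 a b c d ** mat2 a' b' c' d' = mat2 (a*a' + b*c') (a*b' + b*d') (c*a' + d*c') (c*b' + d*d')"
  by (rule mat2_eqI) (simp_all add: matrix_mult_2_nth)

lemma mat_1_eq_mat2: "mat 1 = mat2 1 0 0 1"
  by (rule mat2_eqI) (simp_all add: mat_def)

lemma det_mat2 [simp]: "det (mat2 a b c d) = a * d - b * c"
  by (simp add: det_2)

lemma bounded_linear_nth_nth: "bounded_linear (\<lambda>A :: real^2^2. A $ i $ j)"
  by (intro bounded_linear_compose[OF bounded_linear_vec_nth] bounded_linear_vec_nth)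

lemma real_analytic_at_nth_nth:
  assumes "real_analytic_at F p"
  shows "real_analytic_at (\<lambda>x. (F x :: real^2^2) $ i $ j) p"
  by (rule real_analytic_at_bounded_linear_compose[OF assms bounded_linear_nth_nth])

lemma real_analytic_at_matrixI:
  fixes F :: "'a::real_normed_vector \<Rightarrow> real^2^2"
  assumes "\<And>i j. real_analytic_at (\<lambda>x. F x $ i $ j) p"
  shows "real_analytic_at F p"
proof -
  have eq: "F x = (\<Sum>i\<in>UNIV. \<Sum>j\<in>UNIV. (F x $ i $ j) *\<^sub>R axis i (axis j 1))" for x
    by (rule mat2_eqI) (simp_all add: sum_2 axis_def)
  have "real_analytic_at (\<lambda>x. \<Sum>i\<in>UNIV. \<Sum>j\<in>UNIV. (F x $ i $ j) *\<^sub>R (axis i (axis j 1) :: real^2^2)) p"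
    by (intro real_analytic_at_sum real_analytic_at_bounded_linear_compose[OF assms]
        bounded_linear_scaleR_left)
  then show ?thesis using eq by (simp flip: eq)
qed

lemma real_analytic_at_mat2:
  assumes "real_analytic_at a p" "real_analytic_at b p" "real_analytic_at c p" "real_analytic_at d p"
  shows "real_analytic_at (\<lambda>x. mat2 (a x) (b x) (c x) (d x)) p"
proof (rule real_analytic_at_matrixI)
  fix i j :: 2
  show "real_analytic_at (\<lambda>x. mat2 (a x) (b x) (c x) (d x) $ i $ j) p"
    using exhaust_2[of i] exhaust_2[of j] assms by auto
qed

lemma real_analytic_at_matrix_mult:
  assumes "real_analytic_at F p" "real_analytic_at G p"
  shows "real_analytic_at (\<lambda>x. (F x :: real^2^2) ** (G x :: real^2^2)) p"
  by (rule real_analytic_at_matrixI, unfold matrix_mult_2_nth)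
    (intro real_analytic_at_add real_analytic_at_mult real_analytic_at_nth_nth assms)

text \<open>The adjugate. For determinant 1 it is the inverse, and its entries are linear in those
  of \<open>A\<close>, so inversion requires no division.\<close>

definition adj2 :: "real^2^2 \<Rightarrow> real^2^2" where
  "adj2 A = mat2 (A$2$2) (- A$1$2) (- A$2$1) (A$1$1)"

lemma real_analytic_at_uminus:
  assumes "real_analytic_at f p" shows "real_analytic_at (\<lambda>x. - f x) p"
  by (rule real_analytic_at_bounded_linear_compose[OF assms bounded_linear_minus[OF bounded_linear_ident]])

lemma real_analytic_at_adj2:
  assumes "real_analytic_at F p" shows "real_analytic_at (\<lambda>x. adj2 (F x)) p"
  unfolding adj2_def
  by (intro real_analytic_at_mat2 real_analytic_at_uminus real_analytic_at_nth_nth assms)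

lemma adj2_mult: "det A = 1 \<Longrightarrow> adj2 A ** A = mat 1" "det A = 1 \<Longrightarrow> A ** adj2 A = mat 1"
  unfolding mat_1_eq_mat2 by (auto simp: adj2_def matrix_mult_2_nth det_2 algebra_simps intro!: mat2_eqI)

lemma det_adj2: "det (adj2 A) = det A"
  by (simp add: adj2_def det_2)

lemma isCont_matrix_ops:
  "isCont (\<lambda>(A :: real^2^2, B :: real^2^2). A ** B) x" "isCont adj2 y"
proof -
  have "real_analytic_at (\<lambda>z :: (real^2^2) \<times> (real^2^2). fst z ** snd z) x"
    by (intro real_analytic_at_matrix_mult real_analytic_at_bounded_linear bounded_linear_fst bounded_linear_snd)
  then show "isCont (\<lambda>(A :: real^2^2, B :: real^2^2). A ** B) x"
    using real_analytic_at_imp_isCont by (simp add: case_prod_unfold)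
  show "isCont adj2 y"
    using real_analytic_at_adj2[OF real_analytic_at_bounded_linear[OF bounded_linear_ident]]
    by (rule real_analytic_at_imp_isCont)
qed

lemma group_of_matrices:
  assumes "carrier G = S" "mult G = (**)" "one G = mat 1" "S \<subseteq> {A :: real^2^2. det A = 1}"
    "\<And>A B. A \<in> S \<Longrightarrow> B \<in> S \<Longrightarrow> A ** B \<in> S" "mat 1 \<in> S" "\<And>A. A \<in> S \<Longrightarrow> adj2 A \<in> S"
  shows "group G" "\<And>A. A \<in> S \<Longrightarrow> m_inv G A = adj2 A"
proof -
  have adj: "adj2 A ** A = mat 1" if "A \<in> S" for A using adj2_mult(1) assms(4) that by blast
  show G: "group G"
  proof (rule groupI)
    show "\<exists>y\<in>carrier G. y \<otimes>\<^bsub>G\<^esub> x = \<one>\<^bsub>G\<^esub>" if "x \<in> carrier G" for x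
      using that assms adj by (auto intro!: bexI[of _ "adj2 x"])
  qed (use assms in \<open>auto simp: matrix_mul_assoc\<close>)
  show "m_inv G A = adj2 A" if "A \<in> S" for A
    using group.inv_equality[OF G, of "adj2 A" A] that assms adj by simp
qed

lemma banach_lie_group_of_matrices:
  fixes G :: "(real^2^2, 'e::banach) lie_group"
  assumes "submanifold S (manifold G)"
    and "carrier G = S" "mult G = (**)" "one G = mat 1" "S \<subseteq> {A :: real^2^2. det A = 1}"
    "\<And>A B. A \<in> S \<Longrightarrow> B \<in> S \<Longrightarrow> A ** B \<in> S" "mat 1 \<in> S" "\<And>A. A \<in> S \<Longrightarrow> adj2 A \<in> S"
  shows "banach_lie_group G"
  unfolding banach_lie_group_def
proof (intro conjI)
  show "group G" by (rule group_of_matrices[OF assms(2-)])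
  show "analytic_manifold (manifold G)" by (rule submanifold_imp_analytic_manifold[OF assms(1)])
  show "topspace (mtop (manifold G)) = carrier G" using assms(1,2) by (simp add: submanifold_def)
  have "analytic_map (prod_manifold (manifold G) (manifold G)) (manifold G) (\<lambda>(A, B). A ** B)"
  proof (rule submanifold_analytic_map[OF submanifold_prod[OF assms(1,1)] assms(1), where g="\<lambda>(A, B). A ** B"])
    show "continuous_on (S \<times> S) (\<lambda>(A, B). A ** B)"
      by (intro continuous_at_imp_continuous_on ballI isCont_matrix_ops)
    fix \<iota> :: "'e \<times> 'e \<Rightarrow> (real^2^2) \<times> (real^2^2)" and p
    assume *: "real_analytic_at \<iota> p"
    have "real_analytic_at (\<lambda>x. fst (\<iota> x) ** snd (\<iota> x)) p"
      by (intro real_analytic_at_matrix_mult real_analytic_at_bounded_linear_compose[OF *]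
          bounded_linear_fst bounded_linear_snd)
    then show "real_analytic_at (\<lambda>x. case \<iota> x of (A, B) \<Rightarrow> A ** B) p"
      by (simp add: case_prod_unfold)
  qed (use assms(6) in auto)
  then show "analytic_map (prod_manifold (manifold G) (manifold G)) (manifold G)
      (\<lambda>(x, y). x \<otimes>\<^bsub>G\<^esub> y)" using assms(3) by simp
  show "analytic_map (manifold G) (manifold G) (m_inv G)"
  proof (rule submanifold_analytic_map[OF assms(1,1), where g=adj2])
    show "continuous_on S adj2"
      by (intro continuous_at_imp_continuous_on ballI isCont_matrix_ops)
  qed (use assms(8) in \<open>auto simp: real_analytic_at_adj2 group_of_matrices[OF assms(2-)]\<close>)
qed

section \<open>The two matrix groups as Banach--Lie groups\<close>

lemma real_analytic_at_fst: "real_analytic_at F p \<Longrightarrow> real_analytic_at (\<lambda>x. fst (F x)) p"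
  by (rule real_analytic_at_bounded_linear_compose[OF _ bounded_linear_fst])

lemma real_analytic_at_snd: "real_analytic_at F p \<Longrightarrow> real_analytic_at (\<lambda>x. snd (F x)) p"
  by (rule real_analytic_at_bounded_linear_compose[OF _ bounded_linear_snd])

lemma submanifold_SL2R: "submanifold {A. det A = 1} (manifold SL2R)"
proof -
  let ?S = "{A :: real^2^2. det A = 1}"
  have op: "openin (top_of_set ?S) {A. det A = 1 \<and> A$i$j \<noteq> 0}" for i j
  proof -
    have "open {A :: real^2^2. A$i$j \<noteq> 0}"
      by (intro open_Collect_neq linear_continuous_on bounded_linear_nth_nth continuous_on_const)
    then have "openin (top_of_set ?S) (?S \<inter> {A. A$i$j \<noteq> 0})" by (rule openin_open_Int)
    then show ?thesis by (simp add: Int_def)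
  qed
  have op3: "open {p :: real \<times> real \<times> real. L p \<noteq> 0}" if "bounded_linear L" for L
    by (intro open_Collect_neq linear_continuous_on that continuous_on_const)
  have bl: "bounded_linear (\<lambda>A :: real^2^2. (A$1$1, A$1$2, A$2$i))" for i
    by (intro bounded_linear_Pair bounded_linear_nth_nth)
  let ?U = "{A :: real^2^2. det A = 1 \<and> A$1$1 \<noteq> 0}" and ?\<phi> = "\<lambda>A :: real^2^2. (A$1$1, A$1$2, A$2$1)"
  \<comment> \<open>The equation \<open>det A = 1\<close> solved for the entry (2,2).\<close>
  let ?\<iota> = "\<lambda>p. mat2 (fst p) (fst (snd p)) (snd (snd p)) ((1 + fst (snd p) * snd (snd p)) * inverse (fst p))"
  have U: "\<forall>A\<in>?U. ?\<iota> (?\<phi> A) = A"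
    by (auto intro!: mat2_eqI simp: det_2 field_simps)
  have imgU: "?\<phi> ` ?U = {p. fst p \<noteq> 0}"
  proof (intro equalityI subsetI)
    fix p :: "real \<times> real \<times> real" assume "p \<in> {p. fst p \<noteq> 0}"
    then have "?\<iota> p \<in> ?U" "p = ?\<phi> (?\<iota> p)" by (auto simp: field_simps)
    then show "p \<in> ?\<phi> ` ?U" by blast
  qed auto
  have anU: "real_analytic_at ?\<iota> p" if "fst p \<noteq> 0" for p :: "real \<times> real \<times> real"
    using that
    by (intro real_analytic_at_mat2 real_analytic_at_mult real_analytic_at_add real_analytic_at_const
        real_analytic_at_fst real_analytic_at_snd real_analytic_at_bounded_linear[OF bounded_linear_ident]
        real_analytic_at_compose_bounded_linear[OF real_analytic_at_inverse] bounded_linear_fst)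
  let ?V = "{A :: real^2^2. det A = 1 \<and> A$1$2 \<noteq> 0}" and ?\<psi> = "\<lambda>A :: real^2^2. (A$1$1, A$1$2, A$2$2)"
  \<comment> \<open>The equation \<open>det A = 1\<close> solved for the entry (2,1); the difference
    is written as a sum with \<open>- 1\<close> to match closure under addition.\<close>
  let ?\<kappa> = "\<lambda>p. mat2 (fst p) (fst (snd p)) ((fst p * snd (snd p) + - 1) * inverse (fst (snd p))) (snd (snd p))"
  have V: "\<forall>A\<in>?V. ?\<kappa> (?\<psi> A) = A"
    by (auto intro!: mat2_eqI simp: det_2 field_simps)
  have imgV: "?\<psi> ` ?V = {p. fst (snd p) \<noteq> 0}"
  proof (intro equalityI subsetI)
    fix p :: "real \<times> real \<times> real" assume "p \<in> {p. fst (snd p) \<noteq> 0}"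
    then have "?\<kappa> p \<in> ?V" "p = ?\<psi> (?\<kappa> p)" by (auto simp: field_simps)
    then show "p \<in> ?\<psi> ` ?V" by blast
  qed auto
  have bl2: "bounded_linear (\<lambda>p :: real \<times> real \<times> real. fst (snd p))"
    by (intro bounded_linear_compose[OF bounded_linear_fst] bounded_linear_snd)
  have anV: "real_analytic_at ?\<kappa> p" if "fst (snd p) \<noteq> 0" for p :: "real \<times> real \<times> real"
    using that
    by (intro real_analytic_at_mat2 real_analytic_at_mult real_analytic_at_add real_analytic_at_const
        real_analytic_at_fst real_analytic_at_snd real_analytic_at_bounded_linear[OF bounded_linear_ident]
        real_analytic_at_compose_bounded_linear[OF real_analytic_at_inverse bl2])
  have "?U \<union> ?V = ?S" by (auto simp: det_2)
  moreover have "\<exists>\<iota>. (\<forall>A\<in>?U. \<iota> (?\<phi> A) = A) \<and> (\<forall>p\<in>?\<phi> ` ?U. real_analytic_at \<iota> p)"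
    unfolding imgU using U anU by (intro exI[of _ ?\<iota>]) auto
  moreover have "\<exists>\<iota>. (\<forall>A\<in>?V. \<iota> (?\<psi> A) = A) \<and> (\<forall>p\<in>?\<psi> ` ?V. real_analytic_at \<iota> p)"
    unfolding imgV using V anV by (intro exI[of _ ?\<kappa>]) auto
  moreover have "open (?\<phi> ` ?U)" "open (?\<psi> ` ?V)"
    unfolding imgU imgV using op3[OF bounded_linear_fst] op3[OF bl2] by auto
  ultimately show ?thesis unfolding submanifold_def SL2R_def using op bl by simp
qed

lemma submanifold_SL2R_upper: "submanifold {A. det A = 1 \<and> A$2$1 = 0} (manifold SL2R_upper)"
proof -
  let ?U = "{A :: real^2^2. det A = 1 \<and> A$2$1 = 0}" and ?\<phi> = "\<lambda>A :: real^2^2. (A$1$1, A$1$2)"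
  let ?\<iota> = "\<lambda>p. mat2 (fst p) (snd p) 0 (inverse (fst p))"
  have bl: "bounded_linear ?\<phi>" by (intro bounded_linear_Pair bounded_linear_nth_nth)
  have U: "\<forall>A\<in>?U. ?\<iota> (?\<phi> A) = A"
    by (auto intro!: mat2_eqI simp: det_2 inverse_unique mult.commute)
  have imgU: "?\<phi> ` ?U = {p. fst p \<noteq> 0}"
  proof (intro equalityI subsetI)
    fix p :: "real \<times> real" assume "p \<in> {p. fst p \<noteq> 0}"
    then have "?\<iota> p \<in> ?U" "p = ?\<phi> (?\<iota> p)" by (auto simp: field_simps)
    then show "p \<in> ?\<phi> ` ?U" by blast
  qed (auto simp: det_2)
  have anU: "real_analytic_at ?\<iota> p" if "fst p \<noteq> 0" for p :: "real \<times> real"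
    using that
    by (intro real_analytic_at_mat2 real_analytic_at_const
        real_analytic_at_fst real_analytic_at_snd real_analytic_at_bounded_linear[OF bounded_linear_ident]
        real_analytic_at_compose_bounded_linear[OF real_analytic_at_inverse] bounded_linear_fst)
  have "open (?\<phi> ` ?U)"
    unfolding imgU by (intro open_Collect_neq linear_continuous_on bounded_linear_fst continuous_on_const)
  moreover have "\<exists>\<iota>. (\<forall>A\<in>?U. \<iota> (?\<phi> A) = A) \<and> (\<forall>p\<in>?\<phi> ` ?U. real_analytic_at \<iota> p)"
    unfolding imgU using U anU by (intro exI[of _ ?\<iota>]) auto
  ultimately show ?thesis unfolding submanifold_def SL2R_upper_def using bl by simp
qed

lemma banach_lie_group_SL2R: "banach_lie_group SL2R"
  by (rule banach_lie_group_of_matrices[OF submanifold_SL2R])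
    (auto simp: SL2R_def det_mul det_adj2)

lemma banach_lie_group_SL2R_upper: "banach_lie_group SL2R_upper"
proof (rule banach_lie_group_of_matrices[OF submanifold_SL2R_upper])
  fix A :: "real^2^2" assume "A \<in> {A. det A = 1 \<and> A$2$1 = 0}"
  then show "adj2 A \<in> {A. det A = 1 \<and> A$2$1 = 0}" by (simp add: det_adj2) (simp add: adj2_def)
qed (auto simp: SL2R_upper_def det_mul matrix_mult_2_nth mat_1_eq_mat2)

lemma inclusion_banach_lie_hom: "(\<lambda>A. A) \<in> banach_lie_hom SL2R_upper SL2R"
proof -
  have "analytic_map (manifold SL2R_upper) (manifold SL2R) (\<lambda>A. A)"
    by (rule submanifold_analytic_map[OF submanifold_SL2R_upper submanifold_SL2R, where g="\<lambda>A. A"]) auto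
  then show ?thesis by (auto simp: banach_lie_hom_def hom_def SL2R_def SL2R_upper_def)
qed

section \<open>Leading terms and highest weight vectors\<close>

lemma real_analytic_at_translate:
  assumes "real_analytic_at f a" shows "real_analytic_at (\<lambda>h. f (a + h)) 0"
  using assms unfolding real_analytic_at_def by simp

text \<open>On the real line, with \<open>x = 1\<close>, this turns the homogeneous terms of an
  analytic map into monomials \<open>s ^ n\<close> with fixed coefficients.\<close>

lemma multilinear_scale:
  assumes "multilinear n m"
  shows "m (\<lambda>_. s *\<^sub>R x) = s ^ n *\<^sub>R m (\<lambda>_. x)"
proof -
  define F where "F = (\<lambda>k. m (\<lambda>i. if i < k then s *\<^sub>R x else x))"
  have "F k = s ^ k *\<^sub>R m (\<lambda>_. x)" if "k \<le> n" for k
    using that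
  proof (induction k)
    case (Suc k)
    let ?v = "\<lambda>i. if i < k then s *\<^sub>R x else x"
    have "F (Suc k) = m (?v(k := s *\<^sub>R x))" "F k = m (?v(k := x))"
      unfolding F_def by (auto intro!: arg_cong[where f=m])
    then have "F (Suc k) = s *\<^sub>R F k"
      using linear_scale[OF multilinear_linear[OF assms, of k ?v]] Suc.prems by simp
    then show ?case using Suc by simp
  qed (simp add: F_def)
  moreover have "F n = m (\<lambda>_. s *\<^sub>R x)" unfolding F_def by (rule multilinear_cong[OF assms]) auto
  ultimately show ?thesis by simp
qed

text \<open>Either all Taylor coefficients vanish, and then so does \<open>f\<close> near 0, or
  division by \<open>s ^ k\<close>, with \<open>k\<close> the first nonvanishing degree, leaves an
  analytic function with nonzero value \<open>d\<close> at 0. A flat smooth function could escape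
  both cases. The assumption \<open>f 0 = 0\<close> makes \<open>k\<close> positive.\<close>

lemma real_analytic_at_0_order:
  fixes f :: "real \<Rightarrow> 'b::banach"
  assumes "real_analytic_at f 0" "f 0 = 0"
  obtains "\<forall>\<^sub>F s in nhds 0. f s = 0"
  | k d where "0 < k" "d \<noteq> 0" "((\<lambda>s. inverse (s ^ k) *\<^sub>R f s) \<longlongrightarrow> d) (at 0)"
proof -
  obtain m C R r where *: "0 < R" "0 < r" "0 \<le> C" "\<And>n. multilinear n (m n)"
    "\<And>n v. norm (m n v) \<le> C * R ^ n * (\<Prod>i<n. norm (v i))"
    "\<And>h. norm h < r \<Longrightarrow> (\<lambda>n. m n (\<lambda>_. h)) sums f (0 + h)"
    using real_analytic_atE[OF assms(1)] by metis
  define c where "c = (\<lambda>n. m n (\<lambda>_. 1))"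
  have sums: "(\<lambda>n. s ^ n *\<^sub>R c n) sums f s" if "\<bar>s\<bar> < r" for s
    using *(6)[of s] that multilinear_scale[OF *(4), of _ s 1] by (simp add: c_def)
  have c_le: "norm (c n) \<le> C * R ^ n" for n using *(5)[of n "\<lambda>_. 1"] by (simp add: c_def)
  \<comment> \<open>Since \<open>0 ^ 0 = 1\<close>, evaluation at 0 returns the constant
    coefficient.\<close>
  have pow0: "(\<lambda>n. 0 ^ n *\<^sub>R b n) sums b 0" for b :: "nat \<Rightarrow> 'b"
  proof -
    have "(\<lambda>n. 0 ^ n *\<^sub>R b n) = (\<lambda>n. if n = 0 then b n else 0)" by (auto simp: power_0_left)
    then show ?thesis using sums_single[of 0 b] by simp
  qed
  have c0: "c 0 = 0" using sums[of 0] *(2) assms(2) sums_unique2[OF pow0[of c]] by simp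
  show ?thesis
  proof (cases "\<forall>n. c n = 0")
    case True
    then have "f s = 0" if "\<bar>s\<bar> < r" for s using sums[OF that] by (simp add: sums_iff)
    then have "\<forall>\<^sub>F s in nhds 0. f s = 0"
      unfolding eventually_nhds_metric using *(2) by (auto simp: dist_norm)
    then show ?thesis using that(1) by blast
  next
    case False
    define k where "k = (LEAST n. c n \<noteq> 0)"
    have k: "c k \<noteq> 0" unfolding k_def using False LeastI_ex[of "\<lambda>n. c n \<noteq> 0"] by blast
    have less_k: "c n = 0" if "n < k" for n using not_less_Least[OF that[unfolded k_def]] by simp
    have "0 < k" using k c0 by (cases k) auto
    \<comment> \<open>The quotient with its singularity at 0 removed; its power series is that of
      \<open>f\<close> shifted by \<open>k\<close>.\<close>
    define g where "g = (\<lambda>s. if s = 0 then c k else inverse (s ^ k) *\<^sub>R f s)"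
    have "real_analytic_at g 0"
    proof (rule real_analytic_atI[where m="\<lambda>n v. (\<Prod>i<n. v i) *\<^sub>R c (n + k)" and C="C * R ^ k"
          and R=R and r=r])
      fix n
      show "multilinear n (\<lambda>v. (\<Prod>i<n. v i) *\<^sub>R c (n + k))"
      proof (rule multilinearI)
        fix v :: "nat \<Rightarrow> real" and i assume i: "i < n"
        have "(\<Prod>j<n. (v(i := y)) j) = y * (\<Prod>j\<in>{..<n} - {i}. v j)" for y
          using i by (subst prod.remove[of _ i]) (auto intro!: prod.cong)
        then show "linear (\<lambda>y. (\<Prod>j<n. (v(i := y)) j) *\<^sub>R c (n + k))"
          by (simp add: linear_iff algebra_simps)
      qed auto
      fix v
      show "norm ((\<Prod>i<n. v i) *\<^sub>R c (n + k)) \<le> C * R ^ k * R ^ n * (\<Prod>i<n. norm (v i))"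
        using mult_right_mono[OF c_le[of "n + k"], of "\<Prod>i<n. norm (v i)"]
        by (simp add: prod_nonneg abs_prod power_add ac_simps)
    next
      fix h :: real assume h: "norm h < r"
      show "(\<lambda>n. (\<Prod>i<n. h) *\<^sub>R c (n + k)) sums g (0 + h)"
      proof (cases "h = 0")
        case True
        then show ?thesis using pow0[of "\<lambda>n. c (n + k)"] by (simp add: g_def)
      next
        case False
        have "(\<lambda>n. h ^ (n + k) *\<^sub>R c (n + k)) sums (f h - (\<Sum>n<k. h ^ n *\<^sub>R c n))"
          using sums_split_initial_segment[OF sums, of h k] h by simp
        also have "(\<Sum>n<k. h ^ n *\<^sub>R c n) = 0" using less_k by simp
        finally have "(\<lambda>n. h ^ (n + k) *\<^sub>R c (n + k)) sums f h" by simp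
        then have "(\<lambda>n. inverse (h ^ k) *\<^sub>R (h ^ (n + k) *\<^sub>R c (n + k))) sums (inverse (h ^ k) *\<^sub>R f h)"
          by (rule sums_scaleR_right)
        moreover have "inverse (h ^ k) * h ^ (n + k) = h ^ n" for n using False by (simp add: power_add)
        ultimately show ?thesis using False by (simp add: g_def)
      qed
    qed (use * in auto)
    then have "isCont g 0" by (rule real_analytic_at_imp_isCont)
    then have "(g \<longlongrightarrow> c k) (at 0)" by (simp add: isCont_def g_def)
    moreover have "\<forall>\<^sub>F s in at 0. g s = inverse (s ^ k) *\<^sub>R f s"
      by (simp add: eventually_at_filter g_def)
    ultimately have "((\<lambda>s. inverse (s ^ k) *\<^sub>R f s) \<longlongrightarrow> c k) (at 0)"
      by (rule Lim_transform_eventually)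
    then show ?thesis using that(2) \<open>0 < k\<close> k by blast
  qed
qed

section \<open>Limits of weighted differences\<close>

text \<open>As \<open>u\<close> converges, it is eventually bounded, so an error of arbitrarily
  small proportion tends to 0.\<close>

lemma tendsto_of_relative_error:
  fixes u w :: "'a \<Rightarrow> 'b::real_normed_vector"
  assumes u: "(u \<longlongrightarrow> d) F" and uw: "\<And>e::real. 0 < e \<Longrightarrow> \<forall>\<^sub>F x in F. norm (u x - w x) \<le> e * norm (u x)"
  shows "(w \<longlongrightarrow> d) F"
proof -
  have "((\<lambda>x. u x - w x) \<longlongrightarrow> 0) F"
  proof (rule tendstoI)
    fix e :: real assume "0 < e"
    define e' where "e' = e / (2 * (norm d + 1))"
    have pos: "0 < norm d + 1" by (simp add: add_nonneg_pos)
    have "0 < e'" using \<open>0 < e\<close> pos by (simp add: e'_def)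
    have "\<forall>\<^sub>F x in F. norm (u x) < norm d + 1"
      using tendsto_norm[OF u] by (rule order_tendstoD) simp
    with uw[OF \<open>0 < e'\<close>] show "\<forall>\<^sub>F x in F. dist (u x - w x) 0 < e"
    proof eventually_elim
      case (elim x)
      have "norm (u x - w x) \<le> e' * (norm d + 1)"
        using elim \<open>0 < e'\<close> by (meson less_eq_real_def mult_left_mono order_trans)
      also have "\<dots> = e / 2" using pos unfolding e'_def by (simp add: field_simps)
      finally show ?case using \<open>0 < e\<close> by simp
    qed
  qed
  from tendsto_diff[OF u this] show ?thesis by simp
qed

text \<open>Chain rule with a free weight: for a path that leaves \<open>a\<close> to order
  \<open>s ^ k\<close>, the choice \<open>c s = inverse (s ^ k)\<close> lets \<open>f'\<close>
  transport its leading coefficient.\<close>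

lemma has_derivative_along:
  fixes c :: "'x \<Rightarrow> real"
  assumes f: "(f has_derivative f') (at a)" and p: "(p \<longlongrightarrow> a) F"
    and d: "((\<lambda>x. c x *\<^sub>R (p x - a)) \<longlongrightarrow> d) F"
  shows "((\<lambda>x. c x *\<^sub>R (f (p x) - f a)) \<longlongrightarrow> f' d) F"
proof -
  interpret f': bounded_linear f' using f by (rule has_derivative_bounded_linear)
  have "((\<lambda>x. c x *\<^sub>R (f (p x) - f a - f' (p x - a))) \<longlongrightarrow> 0) F"
  proof (rule tendstoI)
    fix e :: real assume "0 < e"
    define e' where "e' = e / (2 * (norm d + 1))"
    have pos: "0 < norm d + 1" by (simp add: add_nonneg_pos)
    have "0 < e'" using \<open>0 < e\<close> pos by (simp add: e'_def)
    then obtain \<delta> where \<delta>: "0 < \<delta>" "\<And>y. norm (y - a) < \<delta> \<Longrightarrow> norm (f y - f a - f' (y - a)) \<le> e' * norm (y - a)"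
      using f unfolding has_derivative_at_alt by blast
    have "\<forall>\<^sub>F x in F. norm (p x - a) < \<delta>" using tendstoD[OF p \<delta>(1)] by (simp add: dist_norm)
    moreover have "\<forall>\<^sub>F x in F. norm (c x *\<^sub>R (p x - a)) < norm d + 1"
      using tendsto_norm[OF d] by (rule order_tendstoD) simp
    ultimately show "\<forall>\<^sub>F x in F. dist (c x *\<^sub>R (f (p x) - f a - f' (p x - a))) 0 < e"
    proof eventually_elim
      case (elim x)
      have "norm (c x *\<^sub>R (f (p x) - f a - f' (p x - a))) \<le> \<bar>c x\<bar> * (e' * norm (p x - a))"
        using \<delta>(2)[OF elim(1)] by (simp add: mult_left_mono)
      also have "\<dots> = e' * norm (c x *\<^sub>R (p x - a))" by simp
      also have "\<dots> \<le> e' * (norm d + 1)" using elim(2) \<open>0 < e'\<close> by (intro mult_left_mono) auto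
      also have "\<dots> = e / 2" using pos unfolding e'_def by (simp add: field_simps)
      finally show ?case using \<open>0 < e\<close> by simp
    qed
  qed
  from tendsto_add[OF this f'.tendsto[OF d]]
  have "((\<lambda>x. c x *\<^sub>R (f (p x) - f a - f' (p x - a)) + f' (c x *\<^sub>R (p x - a))) \<longlongrightarrow> f' d) F"
    by simp
  moreover have "c x *\<^sub>R (f (p x) - f a - f' (p x - a)) + f' (c x *\<^sub>R (p x - a)) = c x *\<^sub>R (f (p x) - f a)" for x
    unfolding f'.scaleR by (simp add: scaleR_diff_right)
  ultimately show ?thesis by simp
qed

text \<open>The bound passes to the limit in the difference quotients along
  \<open>v\<close>.\<close>

lemma has_derivative_near_id:
  assumes f: "(f has_derivative f') (at a)"
    and le: "\<forall>\<^sub>F x in nhds a. norm (f x - f a - (x - a)) \<le> K * norm (x - a)"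
  shows "norm (f' v - v) \<le> K * norm v"
proof -
  let ?p = "\<lambda>t::real. a + t *\<^sub>R v"
  have p: "(?p \<longlongrightarrow> a) (at 0)" by (auto intro!: tendsto_eq_intros)
  have "\<forall>\<^sub>F t in at (0::real). inverse t *\<^sub>R (?p t - a) = v" by (simp add: eventually_at_filter)
  then have d: "((\<lambda>t. inverse t *\<^sub>R (?p t - a)) \<longlongrightarrow> v) (at 0)"
    by (simp add: tendsto_eventually)
  have "((\<lambda>t. norm (inverse t *\<^sub>R (f (?p t) - f a) - inverse t *\<^sub>R (?p t - a))) \<longlongrightarrow> norm (f' v - v)) (at 0)"
    by (intro tendsto_norm tendsto_diff has_derivative_along[OF f p d] d)
  moreover have "\<forall>\<^sub>F t in at 0. norm (inverse t *\<^sub>R (f (?p t) - f a) - inverse t *\<^sub>R (?p t - a)) \<le> K * norm v"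
    using eventually_compose_filterlim[OF le p] eventually_neq_at_within[of 0]
  proof eventually_elim
    case (elim t)
    have "norm (inverse t *\<^sub>R (f (?p t) - f a) - inverse t *\<^sub>R (?p t - a))
      = \<bar>inverse t\<bar> * norm (f (?p t) - f a - (?p t - a))"
      by (simp only: scaleR_diff_right[symmetric] norm_scaleR)
    also have "\<dots> \<le> \<bar>inverse t\<bar> * (K * norm (?p t - a))" using elim by (intro mult_left_mono) auto
    also have "\<dots> = K * norm v" using elim by (simp add: abs_mult[symmetric])
    finally show ?case .
  qed
  ultimately show ?thesis by (rule tendsto_upperbound) simp
qed

section \<open>Exclusion of negative highest weights\<close>

lemma bounded_linear_funpow:
  fixes f :: "'a::real_normed_vector \<Rightarrow> 'a"
  shows "bounded_linear f \<Longrightarrow> bounded_linear (f ^^ n)"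
proof (induction n)
  case 0
  then show ?case by (simp add: id_def bounded_linear_ident)
next
  case (Suc n)
  then show ?case using bounded_linear_compose[of f "f ^^ n"] by (simp add: o_def)
qed

lemma funpow_apply_commute: "(\<And>x. f (g x) = g (f x)) \<Longrightarrow> (f ^^ n) (g x) = g ((f ^^ n) x)"
  by (induction n) auto

text \<open>The scaling says that \<open>d\<close> has weight \<open>-2k\<close>, the invariance
  that it is a highest weight vector. The two hypotheses near the identity express norm continuity:
  the lower one bounds a difference operator, the upper one controls the orbit of
  \<open>\<rho> W d\<close>. Positivity of \<open>k\<close> is essential, as the trivial
  representation shows.\<close>

lemma no_negative_highest_weight_vector:
  fixes \<rho> :: "real^2^2 \<Rightarrow> 'z::real_normed_vector \<Rightarrow> 'z" and k :: nat
  assumes lin: "\<And>A. det A = 1 \<Longrightarrow> bounded_linear (\<rho> A)"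
    and hom: "\<And>A B v. det A = 1 \<Longrightarrow> det B = 1 \<Longrightarrow> \<rho> (A ** B) v = \<rho> A (\<rho> B v)"
    and diag: "\<And>a. a \<noteq> 0 \<Longrightarrow> \<rho> (mat2 a 0 0 (inverse a)) d = (inverse a ^ 2) ^ k *\<^sub>R d"
    and upper: "\<And>t. \<rho> (mat2 1 t 0 1) d = d"
    and lower_near: "\<forall>\<^sub>F s in nhds 0. \<forall>v. norm (\<rho> (mat2 1 0 s 1) v - v) \<le> norm v / 2"
    and upper_near: "\<forall>\<^sub>F s in nhds 0. \<forall>v. norm (\<rho> (mat2 1 s 0 1) v - v) \<le> norm v / 2"
    and k: "0 < k"
  shows "d = 0"
proof (rule ccontr)
  assume "d \<noteq> 0"
  obtain \<delta> where \<delta>: "0 < \<delta>" "\<And>s v. \<bar>s\<bar> < \<delta> \<Longrightarrow> norm (\<rho> (mat2 1 0 s 1) v - v) \<le> norm v / 2"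
    using lower_near unfolding eventually_nhds_metric by (auto simp: dist_norm)
  define h where "h = \<delta> / 2"
  define P where "P = \<rho> (mat2 1 0 h 1)"
  define Q where "Q = (\<lambda>v. P v - v)"
  define S where "S = (\<lambda>v. P v + v)"
  \<comment> \<open>Conjugation by \<open>diag (a, 1/a)\<close> multiplies the lower entry by
    \<open>a^(-2)\<close>; for \<open>a = 1 / sqrt 2\<close> it is doubled, so that
    \<open>T P = P^2 T\<close>. Factoring \<open>P^2 - 1 = Q S\<close> turns this into
    \<open>T Q = Q S T\<close>.\<close>
  define T where "T = \<rho> (mat2 (inverse (sqrt 2)) 0 0 (inverse (inverse (sqrt 2))))"
  have "0 < h" using \<delta> by (simp add: h_def)
  interpret P: bounded_linear P unfolding P_def by (rule lin) simp
  interpret T: bounded_linear T unfolding T_def by (rule lin) simp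
  have Q: "bounded_linear Q" unfolding Q_def by (intro bounded_linear_sub P.bounded_linear_axioms bounded_linear_ident)
  have Q_le: "norm (Q v) \<le> norm v / 2" for v
    unfolding Q_def P_def by (rule \<delta>(2)) (use \<delta> in \<open>simp add: h_def\<close>)
  have TP: "T (P v) = P (P (T v))" for v
  proof -
    let ?t = "mat2 (inverse (sqrt 2)) 0 0 (inverse (inverse (sqrt 2)))" and ?n = "mat2 1 0 h 1"
    have "inverse (inverse (sqrt 2)) * h = h * inverse (sqrt 2) + h * inverse (sqrt 2)"
      using real_div_sqrt[of 2] by (simp add: field_simps)
    then have "?t ** ?n = ?n ** (?n ** ?t)"
      by (intro mat2_eqI) (simp_all only: matrix_mult_2_nth mat2_nth mult_1 mult_1_right mult_zero_left mult_zero_right add_0 add_0_right)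
    moreover have "\<rho> (?t ** ?n) v = \<rho> ?t (\<rho> ?n v)" "\<rho> (?n ** (?n ** ?t)) v = \<rho> ?n (\<rho> ?n (\<rho> ?t v))"
      by (simp_all add: hom det_mul)
    ultimately show ?thesis by (simp add: T_def P_def)
  qed
  have TQ: "T (Q v) = Q (S (T v))" for v
    by (simp add: Q_def S_def TP T.diff P.add)
  have QS: "Q (S v) = S (Q v)" for v by (simp add: Q_def S_def P.add P.diff)
  have TQn: "T ((Q ^^ n) v) = (Q ^^ n) ((S ^^ n) (T v))" for n v
  proof (induction n)
    case (Suc n)
    have "T ((Q ^^ Suc n) v) = Q (S ((Q ^^ n) ((S ^^ n) (T v))))" by (simp add: TQ Suc)
    also have "\<dots> = Q ((Q ^^ n) (S ((S ^^ n) (T v))))" using funpow_apply_commute[of Q S, OF QS] by simp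
    finally show ?case by simp
  qed simp
  \<comment> \<open>\<open>S\<close> is 2 plus the perturbation \<open>Q\<close> of norm at most
    1/2, so it stretches every vector by at least 3/2.\<close>
  have S_ge: "(3/2) ^ n * norm z \<le> norm ((S ^^ n) z)" for n z
  proof (induction n)
    case (Suc n)
    let ?y = "(S ^^ n) z"
    have "S ?y = 2 *\<^sub>R ?y + Q ?y" by (simp add: S_def Q_def scaleR_2)
    then have "norm (S ?y) \<ge> norm (2 *\<^sub>R ?y) - norm (Q ?y)" using norm_diff_ineq by metis
    with Q_le[of ?y] have "norm (S ?y) \<ge> 3/2 * norm ?y" by simp
    with Suc show ?case by simp
  qed simp
  \<comment> \<open>\<open>T\<close> maps \<open>Q^n d\<close> to \<open>2^k (Q + 2)^n (Q^n d)\<close>, which outgrows the bound on \<open>T\<close> unless \<open>Q^n d = 0\<close>.\<close>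
  obtain K where K: "0 < K" "\<And>x. norm (T x) \<le> norm x * K" using T.pos_bounded by blast
  obtain n where n: "K < (3/2) ^ n" using real_arch_pow[of "3/2" K] by auto
  have "(Q ^^ n) d = 0"
  proof (rule ccontr)
    assume nz: "(Q ^^ n) d \<noteq> 0"
    have Td: "T d = 2 ^ k *\<^sub>R d"
      unfolding T_def by (subst diag) simp_all
    have S: "bounded_linear S" unfolding S_def by (intro bounded_linear_add P.bounded_linear_axioms bounded_linear_ident)
    have lin': "linear ((Q ^^ n))" "linear (S ^^ n)"
      using bounded_linear_funpow[OF Q] bounded_linear_funpow[OF S] bounded_linear.linear by blast+
    have "T ((Q ^^ n) d) = 2 ^ k *\<^sub>R (Q ^^ n) ((S ^^ n) d)"
      by (simp add: TQn Td linear_scale[OF lin'(1)] linear_scale[OF lin'(2)])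
    also have "(Q ^^ n) ((S ^^ n) d) = (S ^^ n) ((Q ^^ n) d)"
      by (rule funpow_apply_commute) (rule funpow_apply_commute[of S Q, OF QS[symmetric], symmetric])
    finally have "norm (T ((Q ^^ n) d)) = 2 ^ k * norm ((S ^^ n) ((Q ^^ n) d))" by simp
    also have "\<dots> \<ge> 1 * ((3/2) ^ n * norm ((Q ^^ n) d))"
      by (intro mult_mono S_ge) auto
    finally have "(3/2) ^ n * norm ((Q ^^ n) d) \<le> K * norm ((Q ^^ n) d)"
      using K(2)[of "(Q ^^ n) d"] by (simp add: ac_simps)
    then show False using nz n by simp
  qed
  \<comment> \<open>The last nonzero iterate is killed by \<open>Q\<close>, hence fixed by
    \<open>P\<close>.\<close>
  then obtain m where m: "(Q ^^ m) d \<noteq> 0" "Q ((Q ^^ m) d) = 0"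
  proof -
    assume a: "\<And>m. (Q ^^ m) d \<noteq> 0 \<Longrightarrow> Q ((Q ^^ m) d) = 0 \<Longrightarrow> thesis"
    define N where "N = (LEAST n. (Q ^^ n) d = 0)"
    have N: "(Q ^^ N) d = 0" unfolding N_def using \<open>(Q ^^ n) d = 0\<close> by (rule LeastI)
    then obtain m where "N = Suc m" using \<open>d \<noteq> 0\<close> by (cases N) auto
    with N show thesis using a[of m] not_less_Least[of m "\<lambda>n. (Q ^^ n) d = 0"] unfolding N_def[symmetric] by simp
  qed
  let ?z = "(Q ^^ m) d"
  have "P ?z = ?z" using m(2) by (simp add: Q_def)
  then have fixed: "(P ^^ j) ?z = ?z" for j by (induction j) auto
  have Pj: "(P ^^ Suc j) v = \<rho> (mat2 1 0 (real (Suc j) * h) 1) v" for j v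
  proof (induction j)
    case (Suc j)
    have "(P ^^ Suc (Suc j)) v = \<rho> (mat2 1 0 h 1) (\<rho> (mat2 1 0 (real (Suc j) * h) 1) v)"
      using Suc by (simp add: P_def)
    then show ?case by (simp flip: hom) (simp add: mat2_mult algebra_simps)
  qed (simp add: P_def)
  \<comment> \<open>The Bruhat decomposition of a lower unipotent with large entry makes \<open>P^j d\<close> tend to 0, whereas
    \<open>Q^m (P^j d)\<close> is the constant \<open>Q^m d\<close>.\<close>
  define W where "W = mat2 0 (-1) 1 0"
  have lower: "\<rho> (mat2 1 0 y 1) d = (inverse y ^ 2) ^ k *\<^sub>R \<rho> (mat2 1 (inverse y) 0 1) (\<rho> W d)" if "y \<noteq> 0" for y
  proof -
    have "mat2 1 0 y 1 = mat2 1 (inverse y) 0 1 ** (W ** (mat2 y 0 0 (inverse y) ** mat2 1 (inverse y) 0 1))"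
      using that by (simp add: W_def mat2_mult)
    then have "\<rho> (mat2 1 0 y 1) d = \<rho> (mat2 1 (inverse y) 0 1) (\<rho> W (\<rho> (mat2 y 0 0 (inverse y)) d))"
      using that by (simp add: hom upper W_def det_mul)
    also have "\<dots> = (inverse y ^ 2) ^ k *\<^sub>R \<rho> (mat2 1 (inverse y) 0 1) (\<rho> W d)"
      using that linear_scale[OF bounded_linear.linear[OF lin]] by (simp add: diag W_def)
    finally show ?thesis .
  qed
  have y: "LIM j sequentially. real (Suc j) * h :> at_top"
    by (rule filterlim_at_top_mult_tendsto_pos[OF tendsto_const \<open>0 < h\<close>
          filterlim_compose[OF filterlim_real_sequentially]]) (rule filterlim_Suc)
  have inv0: "((\<lambda>j. inverse (real (Suc j) * h)) \<longlongrightarrow> 0) sequentially"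
    using y by (rule tendsto_inverse_0_at_top)
  have "((\<lambda>j. (P ^^ Suc j) d) \<longlongrightarrow> 0) sequentially"
  proof (rule Lim_null_comparison)
    \<comment> \<open>The upper unipotent factor has the small entry \<open>1 / y\<close>, so it is
      within 1/2 of the identity and contributes at most the factor 3/2.\<close>
    show "\<forall>\<^sub>F j in sequentially. norm ((P ^^ Suc j) d)
        \<le> (inverse (real (Suc j) * h) ^ 2) ^ k * (3/2 * norm (\<rho> W d))"
      using eventually_compose_filterlim[OF upper_near inv0]
    proof eventually_elim
      case (elim j)
      let ?y = "real (Suc j) * h" and ?w = "\<rho> W d"
      have "norm (\<rho> (mat2 1 (inverse ?y) 0 1) ?w) \<le> norm (\<rho> (mat2 1 (inverse ?y) 0 1) ?w - ?w) + norm ?w"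
        using norm_triangle_ineq[of "\<rho> (mat2 1 (inverse ?y) 0 1) ?w - ?w" ?w] by simp
      also have "\<dots> \<le> 3/2 * norm ?w" using elim[rule_format, of ?w] by simp
      finally show ?case unfolding Pj using \<open>0 < h\<close>
        by (subst lower) (auto intro!: mult_left_mono simp del: of_nat_Suc)
    qed
    show "(\<lambda>j. (inverse (real (Suc j) * h) ^ 2) ^ k * (3/2 * norm (\<rho> W d))) \<longlonglongrightarrow> 0"
      by (intro tendsto_mult_left_zero tendsto_null_power inv0 k) simp
  qed
  from bounded_linear.tendsto[OF bounded_linear_funpow[OF Q] this]
  have "(\<lambda>j. (Q ^^ m) ((P ^^ Suc j) d)) \<longlonglongrightarrow> 0"
    using linear_0[OF bounded_linear.linear[OF bounded_linear_funpow[OF Q]]] by simp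
  moreover have "(Q ^^ m) ((P ^^ Suc j) d) = ?z" for j
  proof -
    have "P (Q v) = Q (P v)" for v by (simp add: Q_def P.diff)
    then have "(P ^^ i) (Q v) = Q ((P ^^ i) v)" for i v by (rule funpow_apply_commute)
    then have "(Q ^^ m) ((P ^^ Suc j) d) = (P ^^ Suc j) ?z" by (intro funpow_apply_commute) (rule sym)
    then show ?thesis using fixed by (simp only:)
  qed
  ultimately show False using m(1) by (simp add: LIMSEQ_const_iff)
qed

section \<open>The adjoint representation\<close>

locale banach_lie_grp =
  fixes G :: "('k, 'z::banach) lie_group" (structure)
  assumes lie: "banach_lie_group G"
begin

sublocale group G using lie by (simp add: banach_lie_group_def)

section \<open>Chosen charts, convergence and multiplication in coordinates\<close>

text \<open>One chart is fixed around each element, so that limits and derivatives in the group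
  become statements in the model space.\<close>

definition chart_at :: "'k \<Rightarrow> 'k set \<times> ('k \<Rightarrow> 'z)" where
  "chart_at g = (SOME c. c \<in> atlas (manifold G) \<and> g \<in> fst c)"

definition nbh :: "'k \<Rightarrow> 'k set" where "nbh g = fst (chart_at g)"
definition crd :: "'k \<Rightarrow> 'k \<Rightarrow> 'z" where "crd g = snd (chart_at g)"
definition pt :: "'k \<Rightarrow> 'z \<Rightarrow> 'k" where "pt g = the_inv_into (nbh g) (crd g)"

lemma chart_at:
  assumes "g \<in> carrier G" shows "(nbh g, crd g) \<in> atlas (manifold G)" "g \<in> nbh g"
proof -
  have "carrier G = (\<Union>(U, \<phi>)\<in>atlas (manifold G). U)"
    using lie by (simp add: banach_lie_group_def analytic_manifold_def)
  then obtain c where "c \<in> atlas (manifold G) \<and> g \<in> fst c" using assms by fastforce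
  then have "chart_at g \<in> atlas (manifold G) \<and> g \<in> fst (chart_at g)"
    unfolding chart_at_def by (rule someI)
  then show "(nbh g, crd g) \<in> atlas (manifold G)" "g \<in> nbh g" by (simp_all add: nbh_def crd_def)
qed

lemma chart_nbh:
  assumes "g \<in> carrier G"
  shows "nbh g \<subseteq> carrier G" "open (crd g ` nbh g)" "inj_on (crd g) (nbh g)"
proof -
  have c: "chart (mtop (manifold G)) (nbh g) (crd g)" and t: "topspace (mtop (manifold G)) = carrier G"
    using chart_at[OF assms] lie by (auto simp: banach_lie_group_def analytic_manifold_def)
  show 1: "nbh g \<subseteq> carrier G" using c t openin_subset unfolding chart_def by blast
  show "open (crd g ` nbh g)" using c by (simp add: chart_def)
  have "topspace (subtopology (mtop (manifold G)) (nbh g)) = nbh g" using t 1 by auto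
  then show "inj_on (crd g) (nbh g)"
    using c homeomorphic_imp_injective_map unfolding chart_def by metis
qed

lemma pt_crd: "g \<in> carrier G \<Longrightarrow> x \<in> nbh g \<Longrightarrow> pt g (crd g x) = x"
  unfolding pt_def by (rule the_inv_into_f_f[OF chart_nbh(3)])

lemma crd_pt:
  assumes "g \<in> carrier G" "p \<in> crd g ` nbh g" shows "crd g (pt g p) = p" "pt g p \<in> nbh g"
  using assms pt_crd by auto

text \<open>Convergence in the group, tested in the chart chosen at the limit. The condition on
  \<open>nbh g\<close> is included because the values of \<open>crd g\<close> off its domain mean
  nothing.\<close>

definition converges :: "'x filter \<Rightarrow> ('x \<Rightarrow> 'k) \<Rightarrow> 'k \<Rightarrow> bool" where
  "converges F \<gamma> g \<longleftrightarrow> (\<forall>\<^sub>F x in F. \<gamma> x \<in> nbh g) \<and> ((\<lambda>x. crd g (\<gamma> x)) \<longlongrightarrow> crd g g) F"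

text \<open>The group law in coordinates, from the charts at \<open>g\<close> and \<open>h\<close>
  to the chart at their product. It is meaningful only near the base point, where all three elements
  lie in their chart domains.\<close>

definition mul :: "'k \<Rightarrow> 'k \<Rightarrow> 'z \<times> 'z \<Rightarrow> 'z" where
  "mul g h z = crd (g \<otimes> h) (pt g (fst z) \<otimes> pt h (snd z))"

lemma mul_crd:
  assumes "g \<in> carrier G" "h \<in> carrier G" "x \<in> nbh g" "y \<in> nbh h"
  shows "mul g h (crd g x, crd h y) = crd (g \<otimes> h) (x \<otimes> y)"
  using assms by (simp add: mul_def pt_crd)

lemma mul_analytic:
  assumes g: "g \<in> carrier G" and h: "h \<in> carrier G"
  shows "real_analytic_at (mul g h) (crd g g, crd h h)"
    and "\<forall>\<^sub>F z in nhds (crd g g, crd h h). fst z \<in> crd g ` nbh g \<and> snd z \<in> crd h ` nbh h \<and>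
           pt g (fst z) \<otimes> pt h (snd z) \<in> nbh (g \<otimes> h)"
proof -
  let ?m = "\<lambda>(x, y). x \<otimes> y"
  let ?U = "nbh g \<times> nbh h" and ?\<phi> = "map_prod (crd g) (crd h)"
  let ?W = "?\<phi> ` {x \<in> ?U. ?m x \<in> nbh (g \<otimes> h)}"
  have gh: "g \<otimes> h \<in> carrier G" using g h by simp
  have "(?U, ?\<phi>) \<in> atlas (prod_manifold (manifold G) (manifold G))"
    unfolding prod_manifold_def using chart_at(1)[OF g] chart_at(1)[OF h] by auto
  then have an: "real_analytic_on (crd (g \<otimes> h) \<circ> ?m \<circ> the_inv_into ?U ?\<phi>) ?W"
    using lie chart_at(1)[OF gh] unfolding banach_lie_group_def analytic_map_def by blast
  have op: "open ?W" using an by (simp add: real_analytic_on_def)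
  have mem: "(crd g g, crd h h) \<in> ?W" using chart_at(2) g h gh by force
  have inv: "the_inv_into ?U ?\<phi> (?\<phi> z) = z" if "z \<in> ?U" for z
  proof (rule the_inv_into_f_f[OF _ that])
    show "inj_on ?\<phi> ?U" using chart_nbh(3)[OF g] chart_nbh(3)[OF h] by (rule map_prod_inj_on)
  qed
  have W: "fst z \<in> crd g ` nbh g \<and> snd z \<in> crd h ` nbh h \<and> pt g (fst z) \<otimes> pt h (snd z) \<in> nbh (g \<otimes> h)
      \<and> the_inv_into ?U ?\<phi> z = (pt g (fst z), pt h (snd z))" if z: "z \<in> ?W" for z
  proof -
    obtain x y where xy: "x \<in> nbh g" "y \<in> nbh h" "x \<otimes> y \<in> nbh (g \<otimes> h)" "z = ?\<phi> (x, y)"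
      using z by auto
    then show ?thesis using inv[of "(x, y)"] by (simp add: pt_crd g h)
  qed
  show "real_analytic_at (mul g h) (crd g g, crd h h)"
  proof (rule real_analytic_at_transform[OF _ op mem])
    show "real_analytic_at (crd (g \<otimes> h) \<circ> ?m \<circ> the_inv_into ?U ?\<phi>) (crd g g, crd h h)"
      using bspec[OF conjunct2[OF an[unfolded real_analytic_on_def]] mem] .
  qed (use W in \<open>simp add: mul_def\<close>)
  show "\<forall>\<^sub>F z in nhds (crd g g, crd h h). fst z \<in> crd g ` nbh g \<and> snd z \<in> crd h ` nbh h \<and>
           pt g (fst z) \<otimes> pt h (snd z) \<in> nbh (g \<otimes> h)"
    using eventually_nhds_in_open[OF op mem] by (rule eventually_mono) (drule W, blast)
qed

lemma converges_mult:
  assumes g: "g \<in> carrier G" and h: "h \<in> carrier G"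
    and \<gamma>: "converges F \<gamma> g" and \<delta>: "converges F \<delta> h"
  shows "converges F (\<lambda>x. \<gamma> x \<otimes> \<delta> x) (g \<otimes> h)"
proof -
  have t: "((\<lambda>x. (crd g (\<gamma> x), crd h (\<delta> x))) \<longlongrightarrow> (crd g g, crd h h)) F"
    using \<gamma> \<delta> by (intro tendsto_Pair) (auto simp: converges_def)
  have ev: "\<forall>\<^sub>F x in F. \<gamma> x \<in> nbh g" "\<forall>\<^sub>F x in F. \<delta> x \<in> nbh h"
    using \<gamma> \<delta> by (auto simp: converges_def)
  have 1: "\<forall>\<^sub>F x in F. \<gamma> x \<otimes> \<delta> x \<in> nbh (g \<otimes> h)"
    using eventually_compose_filterlim[OF mul_analytic(2)[OF g h] t] ev
    by eventually_elim (simp add: pt_crd g h)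
  have "((\<lambda>x. mul g h (crd g (\<gamma> x), crd h (\<delta> x))) \<longlongrightarrow> mul g h (crd g g, crd h h)) F"
    by (rule isCont_tendsto_compose[OF real_analytic_at_imp_isCont[OF mul_analytic(1)[OF g h]] t])
  then have "((\<lambda>x. crd (g \<otimes> h) (\<gamma> x \<otimes> \<delta> x)) \<longlongrightarrow> mul g h (crd g g, crd h h)) F"
  proof (rule Lim_transform_eventually)
    show "\<forall>\<^sub>F x in F. mul g h (crd g (\<gamma> x), crd h (\<delta> x)) = crd (g \<otimes> h) (\<gamma> x \<otimes> \<delta> x)"
      using ev by eventually_elim (rule mul_crd[OF g h])
  qed
  with 1 show ?thesis unfolding converges_def by (simp add: mul_crd g h chart_at(2))
qed

lemma converges_const: "g \<in> carrier G \<Longrightarrow> converges F (\<lambda>_. g) g"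
  by (simp add: converges_def chart_at(2))

lemma converges_pt: "g \<in> carrier G \<Longrightarrow> converges (nhds (crd g g)) (pt g) g"
proof -
  assume g: "g \<in> carrier G"
  have ev: "\<forall>\<^sub>F p in nhds (crd g g). p \<in> crd g ` nbh g"
    by (intro eventually_nhds_in_open chart_nbh(2) g imageI chart_at(2))
  have "((\<lambda>p. crd g (pt g p)) \<longlongrightarrow> crd g g) (nhds (crd g g))"
  proof (rule Lim_transform_eventually)
    show "((\<lambda>p. p) \<longlongrightarrow> crd g g) (nhds (crd g g))" by (rule filterlim_ident)
    show "\<forall>\<^sub>F p in nhds (crd g g). p = crd g (pt g p)"
      using ev by eventually_elim (simp add: crd_pt g)
  qed
  moreover have "\<forall>\<^sub>F p in nhds (crd g g). pt g p \<in> nbh g"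
    using ev by eventually_elim (simp add: crd_pt g)
  ultimately show ?thesis by (simp add: converges_def)
qed

lemma converges_compose: "converges F \<gamma> g \<Longrightarrow> filterlim \<sigma> F E \<Longrightarrow> converges E (\<lambda>x. \<gamma> (\<sigma> x)) g"
  unfolding converges_def by (auto intro: eventually_compose_filterlim filterlim_compose)

lemma converges_conj:
  assumes g: "g \<in> carrier G" and \<gamma>: "converges F \<gamma> \<one>"
  shows "converges F (\<lambda>x. g \<otimes> \<gamma> x \<otimes> inv g) \<one>"
  using converges_mult[OF _ _ converges_mult[OF g one_closed converges_const[OF g] \<gamma>] converges_const[OF inv_closed[OF g]]]
    g by simp

section \<open>Conjugation and its derivative at the identity\<close>

text \<open>The chart at the identity is arbitrary and need not send it to 0, so this base point is
  carried along.\<close>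

definition e0 :: 'z where "e0 = crd \<one> \<one>"

definition conj_chart :: "'k \<Rightarrow> 'z \<Rightarrow> 'z" where
  "conj_chart g p = crd \<one> (g \<otimes> pt \<one> p \<otimes> inv g)"

lemma converges_pt_one: "converges (nhds e0) (pt \<one>) \<one>"
  unfolding e0_def by (rule converges_pt) simp

lemma conj_chart_e0: "g \<in> carrier G \<Longrightarrow> conj_chart g e0 = e0"
  by (simp add: conj_chart_def e0_def pt_crd chart_at(2))

lemma conj_chart_crd: "x \<in> nbh \<one> \<Longrightarrow> conj_chart g (crd \<one> x) = crd \<one> (g \<otimes> x \<otimes> inv g)"
  by (simp add: conj_chart_def pt_crd)

text \<open>Since \<open>g\<close> may be far from the identity, conjugation factors through the
  chart at \<open>g\<close>: left multiplication leads from the chart at \<open>\<one>\<close> to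
  the chart at \<open>g\<close>, and right multiplication by \<open>inv g\<close> leads
  back.\<close>

lemma conj_chart_differentiable:
  assumes g: "g \<in> carrier G"
  shows "conj_chart g differentiable (at e0)"
proof -
  let ?f = "\<lambda>p. mul g \<one> (crd g g, p)" and ?h = "\<lambda>q. mul g (inv g) (q, crd (inv g) (inv g))"
  have diff: "mul a b differentiable (at (crd a a, crd b b))" if "a \<in> carrier G" "b \<in> carrier G" for a b
    using real_analytic_at_imp_strict_derivative[OF mul_analytic(1)[OF that]]
      strict_derivative_imp_has_derivative unfolding differentiable_def by metis
  have "(\<lambda>p. (crd g g, p)) differentiable (at e0)" "(\<lambda>q. (q, crd (inv g) (inv g))) differentiable (at (crd g g))"
    unfolding differentiable_def by (auto intro!: exI derivative_eq_intros)
  then have "?f differentiable (at e0)" "?h differentiable (at (crd g g))"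
    using diff[OF g one_closed] diff[OF g inv_closed[OF g]]
      differentiable_chain_at[of "\<lambda>p. (crd g g, p)" e0 "mul g \<one>"]
      differentiable_chain_at[of "\<lambda>q. (q, crd (inv g) (inv g))" "crd g g" "mul g (inv g)"]
    by (simp_all add: o_def e0_def)
  moreover have "?f e0 = crd g g" using mul_crd[OF g one_closed chart_at(2)[OF g] chart_at(2)[OF one_closed]] g
    by (simp add: e0_def)
  ultimately have "(\<lambda>p. ?h (?f p)) differentiable (at e0)"
    using differentiable_chain_at[of ?f e0 ?h] by (simp add: o_def)
  then obtain D where D: "((\<lambda>p. ?h (?f p)) has_derivative D) (at e0)" unfolding differentiable_def by blast
  have "converges (nhds e0) (\<lambda>p. g \<otimes> pt \<one> p) g"
    using converges_mult[OF g one_closed converges_const[OF g] converges_pt_one] g by simp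
  then have ev: "\<forall>\<^sub>F p in nhds e0. g \<otimes> pt \<one> p \<in> nbh g" by (simp add: converges_def)
  have ev2: "\<forall>\<^sub>F p in nhds e0. p \<in> crd \<one> ` nbh \<one>"
    unfolding e0_def by (intro eventually_nhds_in_open chart_nbh(2) one_closed imageI chart_at(2))
  \<comment> \<open>Agreement near \<open>e0\<close> suffices for the derivative; there all
    intermediate elements lie in the charts used.\<close>
  have eq: "\<forall>\<^sub>F p in nhds e0. ?h (?f p) = conj_chart g p"
    using ev ev2
  proof eventually_elim
    case (elim p)
    have "?f p = crd g (g \<otimes> pt \<one> p)"
      using mul_crd[OF g one_closed chart_at(2)[OF g] crd_pt(2)[OF one_closed elim(2)]]
        crd_pt(1)[OF one_closed elim(2)] g by simp
    then show ?case
      using mul_crd[OF g inv_closed[OF g] elim(1) chart_at(2)[OF inv_closed[OF g]]] g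
      by (simp add: conj_chart_def)
  qed
  then have "(conj_chart g has_derivative D) (at e0)"
    using has_derivative_transform_eventually[OF D, of "conj_chart g"] eventually_nhds_x_imp_x[OF eq]
    by (simp add: eventually_at_filter eventually_mono)
  then show ?thesis unfolding differentiable_def by blast
qed

text \<open>The adjoint representation, with the tangent space at \<open>\<one>\<close> identified
  with the model space through the chosen chart.\<close>

definition Ad :: "'k \<Rightarrow> 'z \<Rightarrow> 'z" where
  "Ad g = frechet_derivative (conj_chart g) (at e0)"

lemma has_derivative_Ad: "g \<in> carrier G \<Longrightarrow> (conj_chart g has_derivative Ad g) (at e0)"
  unfolding Ad_def using conj_chart_differentiable frechet_derivative_works by blast

lemma bounded_linear_Ad: "g \<in> carrier G \<Longrightarrow> bounded_linear (Ad g)"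
  using has_derivative_Ad has_derivative_bounded_linear by blast

text \<open>Chain rule: near \<open>e0\<close> the composite of two conjugations is the conjugation
  by the product.\<close>

lemma Ad_mult:
  assumes g: "g \<in> carrier G" and h: "h \<in> carrier G"
  shows "Ad (g \<otimes> h) v = Ad g (Ad h v)"
proof -
  have 1: "((\<lambda>p. conj_chart g (conj_chart h p)) has_derivative (\<lambda>v. Ad g (Ad h v))) (at e0)"
    by (rule has_derivative_compose[OF has_derivative_Ad[OF h]])
      (simp add: conj_chart_e0 h has_derivative_Ad g)
  have "\<forall>\<^sub>F p in nhds e0. h \<otimes> pt \<one> p \<otimes> inv h \<in> nbh \<one>" "\<forall>\<^sub>F p in nhds e0. pt \<one> p \<in> nbh \<one>"
    using converges_conj[OF h converges_pt_one] converges_pt_one by (simp_all add: converges_def)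
  then have eq: "\<forall>\<^sub>F p in nhds e0. conj_chart g (conj_chart h p) = conj_chart (g \<otimes> h) p"
  proof eventually_elim
    case (elim p)
    then have "pt \<one> p \<in> carrier G" using chart_nbh(1) by blast
    then have "g \<otimes> (h \<otimes> pt \<one> p \<otimes> inv h) \<otimes> inv g = g \<otimes> h \<otimes> pt \<one> p \<otimes> inv (g \<otimes> h)"
      using g h by (simp add: m_assoc inv_mult_group)
    then show ?case using conj_chart_crd[OF elim(1), of g] by (simp add: conj_chart_def)
  qed
  have "(conj_chart (g \<otimes> h) has_derivative (\<lambda>v. Ad g (Ad h v))) (at e0)"
    using has_derivative_transform_eventually[OF 1, of "conj_chart (g \<otimes> h)"] eventually_nhds_x_imp_x[OF eq] eq
    by (simp add: eventually_at_filter eventually_mono)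
  then have "(\<lambda>v. Ad g (Ad h v)) = Ad (g \<otimes> h)"
    using has_derivative_Ad[of "g \<otimes> h"] g h by (intro has_derivative_unique) auto
  then show ?thesis by metis
qed

section \<open>Comparison of the group law with addition near the identity\<close>

text \<open>The derivative of multiplication at the identity is addition, since either factor may be
  kept equal to \<open>\<one>\<close>. Strictness then makes multiplication additive up to a small
  relative error for any two pairs near the base point.\<close>

lemma mul_one_strict:
  assumes "0 < e"
  obtains d where "0 < d" "\<And>p q p' q'. dist p e0 < d \<Longrightarrow> dist q e0 < d \<Longrightarrow> dist p' e0 < d \<Longrightarrow> dist q' e0 < d \<Longrightarrow>
     norm (mul \<one> \<one> (p, q) - mul \<one> \<one> (p', q') - (p - p') - (q - q')) \<le> e * (norm (p - p') + norm (q - q'))"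
    "\<And>p q. dist p e0 < d \<Longrightarrow> dist q e0 < d \<Longrightarrow> p \<in> crd \<one> ` nbh \<one> \<and> q \<in> crd \<one> ` nbh \<one> \<and> pt \<one> p \<otimes> pt \<one> q \<in> nbh \<one>"
proof -
  obtain L where L: "strict_derivative (mul \<one> \<one>) L (e0, e0)"
    using real_analytic_at_imp_strict_derivative[OF mul_analytic(1)[OF one_closed one_closed]]
    unfolding e0_def by metis
  note hd = strict_derivative_imp_has_derivative[OF L]
  interpret L: bounded_linear L using L by (simp add: strict_derivative_def)
  have ev: "\<forall>\<^sub>F p in nhds e0. p \<in> crd \<one> ` nbh \<one>"
    unfolding e0_def by (intro eventually_nhds_in_open chart_nbh(2) one_closed imageI chart_at(2))
  have m1: "mul \<one> \<one> (p, e0) = p" "mul \<one> \<one> (e0, p) = p" if p: "p \<in> crd \<one> ` nbh \<one>" for p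
  proof -
    note * = crd_pt[OF one_closed p]
    then have "pt \<one> p \<in> carrier G" using chart_nbh(1) by blast
    then show "mul \<one> \<one> (p, e0) = p" "mul \<one> \<one> (e0, p) = p"
      using mul_crd[OF one_closed one_closed *(2) chart_at(2)[OF one_closed]]
        mul_crd[OF one_closed one_closed chart_at(2)[OF one_closed] *(2)] *(1) by (simp_all add: e0_def)
  qed
  have "((\<lambda>p. mul \<one> \<one> (p, e0)) has_derivative (\<lambda>v. L (v, 0))) (at e0)"
    by (rule has_derivative_compose[of "\<lambda>p. (p, e0)" _ e0 UNIV "mul \<one> \<one>" L, OF _ hd])
      (auto intro!: derivative_eq_intros)
  moreover have "((\<lambda>p. mul \<one> \<one> (p, e0)) has_derivative (\<lambda>v. v)) (at e0)"
    using has_derivative_transform_eventually[OF has_derivative_ident, of "\<lambda>p. mul \<one> \<one> (p, e0)" e0 UNIV]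
      eventually_nhds_x_imp_x[OF ev] ev by (simp add: eventually_at_filter eventually_mono m1)
  ultimately have L1: "L (v, 0) = v" for v using has_derivative_unique by metis
  have "((\<lambda>p. mul \<one> \<one> (e0, p)) has_derivative (\<lambda>v. L (0, v))) (at e0)"
    by (rule has_derivative_compose[of "\<lambda>p. (e0, p)" _ e0 UNIV "mul \<one> \<one>" L, OF _ hd])
      (auto intro!: derivative_eq_intros)
  moreover have "((\<lambda>p. mul \<one> \<one> (e0, p)) has_derivative (\<lambda>v. v)) (at e0)"
    using has_derivative_transform_eventually[OF has_derivative_ident, of "\<lambda>p. mul \<one> \<one> (e0, p)" e0 UNIV]
      eventually_nhds_x_imp_x[OF ev] ev by (simp add: eventually_at_filter eventually_mono m1)
  ultimately have L2: "L (0, v) = v" for v using has_derivative_unique by metis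
  have Leq: "L (v, w) = v + w" for v w using L.add[of "(v, 0)" "(0, w)"] L1 L2 by simp
  obtain d1 where d1: "0 < d1" "\<And>x y. x \<in> ball (e0, e0) d1 \<Longrightarrow> y \<in> ball (e0, e0) d1 \<Longrightarrow>
      norm (mul \<one> \<one> x - mul \<one> \<one> y - L (x - y)) \<le> e * norm (x - y)"
    using L assms unfolding strict_derivative_def by metis
  obtain d2 where d2: "0 < d2" "\<And>z. dist z (e0, e0) < d2 \<Longrightarrow> fst z \<in> crd \<one> ` nbh \<one> \<and> snd z \<in> crd \<one> ` nbh \<one> \<and>
           pt \<one> (fst z) \<otimes> pt \<one> (snd z) \<in> nbh \<one>"
    using mul_analytic(2)[OF one_closed one_closed] unfolding eventually_nhds_metric e0_def by auto
  \<comment> \<open>Halving suffices because the norm of a pair is at most the sum of the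
    norms.\<close>
  have near: "dist (p, q) (e0, e0) < D" if "dist p e0 < D / 2" "dist q e0 < D / 2" for p q D
  proof -
    have "dist (p, q) (e0, e0) \<le> dist p e0 + dist q e0"
      using norm_Pair_le[of "p - e0" "q - e0"] by (simp add: dist_norm)
    then show ?thesis using that by simp
  qed
  show ?thesis
  proof (rule that[of "min d1 d2 / 2"])
    fix p q p' q'
    assume "dist p e0 < min d1 d2 / 2" "dist q e0 < min d1 d2 / 2" "dist p' e0 < min d1 d2 / 2" "dist q' e0 < min d1 d2 / 2"
    then have "dist (p, q) (e0, e0) < d1" "dist (p', q') (e0, e0) < d1"
      using near[of p "min d1 d2" q] near[of p' "min d1 d2" q'] by auto
    then have "norm (mul \<one> \<one> (p, q) - mul \<one> \<one> (p', q') - L ((p, q) - (p', q'))) \<le> e * norm ((p, q) - (p', q'))"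
      by (intro d1(2)) (auto simp: dist_commute)
    also have "\<dots> \<le> e * (norm (p - p') + norm (q - q'))"
      using assms norm_Pair_le[of "p - p'" "q - q'"] by (intro mult_left_mono) auto
    finally show "norm (mul \<one> \<one> (p, q) - mul \<one> \<one> (p', q') - (p - p') - (q - q')) \<le> e * (norm (p - p') + norm (q - q'))"
      by (simp add: Leq algebra_simps)
  next
    fix p q assume "dist p e0 < min d1 d2 / 2" "dist q e0 < min d1 d2 / 2"
    then have "dist (p, q) (e0, e0) < d2" using near[of p "min d1 d2" q] by auto
    from d2(2)[OF this] show "p \<in> crd \<one> ` nbh \<one> \<and> q \<in> crd \<one> ` nbh \<one> \<and> pt \<one> p \<otimes> pt \<one> q \<in> nbh \<one>" by simp
  qed (use d1 d2 in auto)
qed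

lemma mul_one:
  assumes "x \<in> nbh \<one>" "y \<in> nbh \<one>" shows "mul \<one> \<one> (crd \<one> x, crd \<one> y) = crd \<one> (x \<otimes> y)"
  using mul_crd[OF one_closed one_closed assms] by simp

lemma in_nbh_one: "x \<in> nbh \<one> \<Longrightarrow> x \<in> carrier G"
  using chart_nbh(1)[OF one_closed] by blast

lemma one_in_nbh: "\<one> \<in> nbh \<one>"
  by (simp add: chart_at(2))

text \<open>Norm continuity of \<open>Ad\<close> at the identity. Conjugation consists of two
  multiplications, each compared with its value at \<open>p = e0\<close> by the two-point estimate;
  the resulting bound for all \<open>p\<close> near \<open>e0\<close> passes to the derivative,
  uniformly in \<open>v\<close>.\<close>

lemma Ad_near_id:
  assumes "0 < e"
  obtains d where "0 < d"
    "\<And>g v. g \<in> nbh \<one> \<Longrightarrow> inv g \<in> nbh \<one> \<Longrightarrow> dist (crd \<one> g) e0 < d \<Longrightarrow> dist (crd \<one> (inv g)) e0 < d \<Longrightarrow>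
       norm (Ad g v - v) \<le> e * norm v"
proof -
  \<comment> \<open>The first product contributes the error \<open>\<epsilon>\<close> and the second
    \<open>2 * \<epsilon>\<close>, because for \<open>\<epsilon> \<le> 1\<close> the intermediate
    displacement is at most twice the original one; the total is
    \<open>3 * \<epsilon>\<close>.\<close>
  define \<epsilon> where "\<epsilon> = min 1 (e / 3)"
  have \<epsilon>: "0 < \<epsilon>" "\<epsilon> \<le> 1" "3 * \<epsilon> \<le> e" using assms by (auto simp: \<epsilon>_def)
  obtain d where d: "0 < d" "\<And>p q p' q'. dist p e0 < d \<Longrightarrow> dist q e0 < d \<Longrightarrow> dist p' e0 < d \<Longrightarrow> dist q' e0 < d \<Longrightarrow>
     norm (mul \<one> \<one> (p, q) - mul \<one> \<one> (p', q') - (p - p') - (q - q')) \<le> \<epsilon> * (norm (p - p') + norm (q - q'))"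
    "\<And>p q. dist p e0 < d \<Longrightarrow> dist q e0 < d \<Longrightarrow> p \<in> crd \<one> ` nbh \<one> \<and> q \<in> crd \<one> ` nbh \<one> \<and> pt \<one> p \<otimes> pt \<one> q \<in> nbh \<one>"
    using mul_one_strict[OF \<epsilon>(1)] by metis
  show ?thesis
  proof (rule that[OF d(1)])
    fix g v
    assume g: "g \<in> nbh \<one>" "inv g \<in> nbh \<one>" and gd: "dist (crd \<one> g) e0 < d" "dist (crd \<one> (inv g)) e0 < d"
    note gc = in_nbh_one[OF g(1)]
    let ?c = "crd \<one> g" and ?ci = "crd \<one> (inv g)"
    \<comment> \<open>The intermediate point \<open>y\<close> differs from the coordinate of
      \<open>g\<close> by at most \<open>2 * norm (p - e0)\<close>; this radius keeps it within
      \<open>d\<close> of \<open>e0\<close>.\<close>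
    define r where "r = min d ((d - dist ?c e0) / 2)"
    have "0 < r" using d(1) gd by (simp add: r_def)
    have "norm (conj_chart g p - conj_chart g e0 - (p - e0)) \<le> e * norm (p - e0)" if p: "dist p e0 < r" for p
    proof -
      have pd: "dist p e0 < d" using p by (simp add: r_def)
      note ptp = d(3)[OF gd(1) pd]
      have x: "pt \<one> p \<in> nbh \<one>" "crd \<one> (pt \<one> p) = p" "g \<otimes> pt \<one> p \<in> nbh \<one>"
        using ptp crd_pt[OF one_closed] pt_crd[OF one_closed g(1)] by auto
      define y where "y = crd \<one> (g \<otimes> pt \<one> p)"
      have y: "mul \<one> \<one> (?c, p) = y" using mul_one[OF g(1) x(1)] by (simp add: x y_def)
      have c: "mul \<one> \<one> (?c, e0) = ?c" using mul_one[OF g(1) one_in_nbh] gc by (simp add: e0_def)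
      have 1: "norm (y - ?c - (p - e0)) \<le> \<epsilon> * norm (p - e0)"
        using d(2)[OF gd(1) pd gd(1), of e0] d(1) by (simp add: y c)
      also have "\<dots> \<le> 1 * norm (p - e0)" using \<epsilon> by (intro mult_right_mono) auto
      finally have 2: "norm (y - ?c) \<le> 2 * norm (p - e0)"
        using norm_triangle_ineq[of "y - ?c - (p - e0)" "p - e0"] by simp
      have yd: "dist y e0 < d"
      proof -
        have "dist y e0 \<le> norm (y - ?c) + dist ?c e0" using dist_triangle[of y e0 ?c] by (simp add: dist_norm)
        also have "\<dots> < d" using 2 p by (simp add: r_def dist_norm field_simps)
        finally show ?thesis .
      qed
      have cj: "mul \<one> \<one> (y, ?ci) = conj_chart g p"
        unfolding y_def mul_one[OF x(3) g(2)] by (simp add: conj_chart_def)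
      have ci: "mul \<one> \<one> (?c, ?ci) = e0" using mul_one[OF g] gc by (simp add: e0_def)
      have "norm (conj_chart g p - e0 - (y - ?c)) \<le> \<epsilon> * norm (y - ?c)"
        using d(2)[OF yd gd(2) gd(1) gd(2)] by (simp add: cj ci)
      also have "\<dots> \<le> \<epsilon> * (2 * norm (p - e0))" using 2 \<epsilon> by (intro mult_left_mono) auto
      finally have "norm (conj_chart g p - e0 - (p - e0)) \<le> \<epsilon> * (2 * norm (p - e0)) + \<epsilon> * norm (p - e0)"
        using 1 norm_triangle_ineq[of "conj_chart g p - e0 - (y - ?c)" "y - ?c - (p - e0)"] by simp
      also have "\<dots> = (3 * \<epsilon>) * norm (p - e0)" by simp
      also have "\<dots> \<le> e * norm (p - e0)" using \<epsilon> by (intro mult_right_mono) auto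
      finally show ?thesis by (simp add: conj_chart_e0 gc)
    qed
    then have "\<forall>\<^sub>F p in nhds e0. norm (conj_chart g p - conj_chart g e0 - (p - e0)) \<le> e * norm (p - e0)"
      unfolding eventually_nhds_metric using \<open>0 < r\<close> by blast
    then show "norm (Ad g v - v) \<le> e * norm v" by (rule has_derivative_near_id[OF has_derivative_Ad[OF gc]])
  qed
qed

lemma eventually_Ad_near_id:
  assumes "converges F \<gamma> \<one>" "converges F (\<lambda>x. inv (\<gamma> x)) \<one>" "0 < e"
  shows "\<forall>\<^sub>F x in F. \<forall>v. norm (Ad (\<gamma> x) v - v) \<le> e * norm v"
proof -
  obtain d where d: "0 < d"
    "\<And>g v. g \<in> nbh \<one> \<Longrightarrow> inv g \<in> nbh \<one> \<Longrightarrow> dist (crd \<one> g) e0 < d \<Longrightarrow> dist (crd \<one> (inv g)) e0 < d \<Longrightarrow>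
       norm (Ad g v - v) \<le> e * norm v"
    using Ad_near_id[OF assms(3)] by metis
  have "\<forall>\<^sub>F x in F. dist (crd \<one> (\<gamma> x)) e0 < d" "\<forall>\<^sub>F x in F. dist (crd \<one> (inv (\<gamma> x))) e0 < d"
    using assms d(1) by (auto simp: converges_def e0_def intro: tendstoD)
  moreover have "\<forall>\<^sub>F x in F. \<gamma> x \<in> nbh \<one>" "\<forall>\<^sub>F x in F. inv (\<gamma> x) \<in> nbh \<one>"
    using assms by (auto simp: converges_def)
  ultimately show ?thesis by eventually_elim (use d in blast)
qed

text \<open>The coordinates of a quotient and the difference of coordinates have the same leading
  term: \<open>x s\<close> is the product of the quotient and \<open>y s\<close>, and near
  \<open>\<one>\<close> multiplication is addition up to a small relative error.\<close>

lemma tendsto_crd_quotient: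
  fixes c :: "'x \<Rightarrow> real"
  assumes x: "converges F x \<one>" and y: "converges F y \<one>" and iy: "converges F (\<lambda>s. inv (y s)) \<one>"
    and d: "((\<lambda>s. c s *\<^sub>R (crd \<one> (x s) - crd \<one> (y s))) \<longlongrightarrow> d) F"
  shows "converges F (\<lambda>s. x s \<otimes> inv (y s)) \<one>"
    and "((\<lambda>s. c s *\<^sub>R (crd \<one> (x s \<otimes> inv (y s)) - e0)) \<longlongrightarrow> d) F"
proof -
  let ?D = "\<lambda>s. x s \<otimes> inv (y s)"
  show D: "converges F ?D \<one>" using converges_mult[OF one_closed one_closed x iy] by simp
  show "((\<lambda>s. c s *\<^sub>R (crd \<one> (?D s) - e0)) \<longlongrightarrow> d) F"
  proof (rule tendsto_of_relative_error[OF d])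
    fix e :: real assume "0 < e"
    \<comment> \<open>The error is at first relative to the quotient \<open>?w\<close>. The bound
      1/2 yields \<open>norm ?w \<le> 2 * norm ?u\<close>, so passing to \<open>?u\<close> costs a
      factor 2, for which \<open>e / 2\<close> allows.\<close>
    define \<epsilon> where "\<epsilon> = min (1/2) (e / 2)"
    have \<epsilon>: "0 < \<epsilon>" "\<epsilon> \<le> 1/2" "2 * \<epsilon> \<le> e" using \<open>0 < e\<close> by (auto simp: \<epsilon>_def)
    obtain \<delta> where \<delta>: "0 < \<delta>" "\<And>p q p' q'. dist p e0 < \<delta> \<Longrightarrow> dist q e0 < \<delta> \<Longrightarrow> dist p' e0 < \<delta> \<Longrightarrow> dist q' e0 < \<delta> \<Longrightarrow>
       norm (mul \<one> \<one> (p, q) - mul \<one> \<one> (p', q') - (p - p') - (q - q')) \<le> \<epsilon> * (norm (p - p') + norm (q - q'))"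
      using mul_one_strict[OF \<epsilon>(1)] by metis
    have "\<forall>\<^sub>F s in F. dist (crd \<one> (?D s)) e0 < \<delta>" "\<forall>\<^sub>F s in F. dist (crd \<one> (y s)) e0 < \<delta>"
      using D y \<delta>(1) by (auto simp: converges_def e0_def intro: tendstoD)
    moreover have "\<forall>\<^sub>F s in F. x s \<in> nbh \<one>" "\<forall>\<^sub>F s in F. y s \<in> nbh \<one>" "\<forall>\<^sub>F s in F. ?D s \<in> nbh \<one>"
      using x y D by (auto simp: converges_def)
    ultimately show "\<forall>\<^sub>F s in F. norm (c s *\<^sub>R (crd \<one> (x s) - crd \<one> (y s)) - c s *\<^sub>R (crd \<one> (?D s) - e0))
        \<le> e * norm (c s *\<^sub>R (crd \<one> (x s) - crd \<one> (y s)))"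
    proof eventually_elim
      case (elim s)
      note xc = in_nbh_one[OF elim(3)] and yc = in_nbh_one[OF elim(4)]
      let ?u = "crd \<one> (x s) - crd \<one> (y s)" and ?w = "crd \<one> (?D s) - e0"
      have "mul \<one> \<one> (crd \<one> (?D s), crd \<one> (y s)) = crd \<one> (x s)"
        using mul_one[OF elim(5,4)] xc yc by (simp add: m_assoc)
      moreover have "mul \<one> \<one> (e0, crd \<one> (y s)) = crd \<one> (y s)"
        using mul_one[OF one_in_nbh elim(4)] yc by (simp add: e0_def)
      ultimately have 1: "norm (?u - ?w) \<le> \<epsilon> * norm ?w"
        using \<delta>(2)[OF elim(1) elim(2) _ elim(2), of e0] \<delta>(1) by simp
      also have "\<dots> \<le> 1/2 * norm ?w" using \<epsilon> by (intro mult_right_mono) auto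
      finally have "norm ?w \<le> 2 * norm ?u"
        using norm_triangle_sub[of ?w ?u] by (simp add: norm_minus_commute)
      then have "\<epsilon> * norm ?w \<le> \<epsilon> * (2 * norm ?u)" using \<epsilon> by (intro mult_left_mono) auto
      also have "\<dots> = (2 * \<epsilon>) * norm ?u" by simp
      also have "\<dots> \<le> e * norm ?u" using \<epsilon> by (intro mult_right_mono) auto
      finally have "norm (?u - ?w) \<le> e * norm ?u" using 1 by simp
      then have "\<bar>c s\<bar> * norm (?u - ?w) \<le> \<bar>c s\<bar> * (e * norm ?u)" by (intro mult_left_mono) auto
      moreover have "norm (c s *\<^sub>R ?u - c s *\<^sub>R ?w) = \<bar>c s\<bar> * norm (?u - ?w)"
        by (simp only: scaleR_diff_right[symmetric] norm_scaleR)
      moreover have "e * norm (c s *\<^sub>R ?u) = \<bar>c s\<bar> * (e * norm ?u)"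
        by (simp only: norm_scaleR mult.left_commute)
      ultimately show ?case by (simp only:)
    qed
  qed
qed

section \<open>Leading terms of curves in the group\<close>

text \<open>The leading coefficient of \<open>s \<mapsto> D (\<sigma> s)\<close>, measured against
  \<open>s ^ k\<close>, is computed in two ways: as that of a conjugate of \<open>D s\<close> it is
  \<open>Ad g d\<close>, and by substitution it is \<open>c ^ k\<close> times
  \<open>d\<close>.\<close>

lemma Ad_scaling:
  fixes D :: "real \<Rightarrow> 'k"
  assumes g: "g \<in> carrier G" and D: "converges (at 0) D \<one>"
    and d: "((\<lambda>s. inverse (s ^ k) *\<^sub>R (crd \<one> (D s) - e0)) \<longlongrightarrow> d) (at 0)"
    and \<sigma>: "filterlim \<sigma> (at 0) (at 0)" and c: "((\<lambda>s. \<sigma> s / s) \<longlongrightarrow> c) (at 0)"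
    and conj: "\<forall>\<^sub>F s in at 0. D (\<sigma> s) = g \<otimes> D s \<otimes> inv g"
  shows "Ad g d = c ^ k *\<^sub>R d"
proof -
  have "((\<lambda>s. crd \<one> (D s)) \<longlongrightarrow> e0) (at 0)" using D by (simp add: converges_def e0_def)
  from has_derivative_along[OF has_derivative_Ad[OF g] this d]
  have "((\<lambda>s. inverse (s ^ k) *\<^sub>R (conj_chart g (crd \<one> (D s)) - e0)) \<longlongrightarrow> Ad g d) (at 0)"
    by (simp add: conj_chart_e0 g)
  \<comment> \<open>The weight \<open>inverse (s ^ k)\<close> is split into
    \<open>(\<sigma> s / s) ^ k\<close> and \<open>inverse (\<sigma> s ^ k)\<close>.\<close>
  moreover have "((\<lambda>s. (\<sigma> s / s) ^ k *\<^sub>R (inverse (\<sigma> s ^ k) *\<^sub>R (crd \<one> (D (\<sigma> s)) - e0))) \<longlongrightarrow> c ^ k *\<^sub>R d) (at 0)"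
    by (intro tendsto_scaleR tendsto_power c filterlim_compose[OF d \<sigma>])
  then have "((\<lambda>s. inverse (s ^ k) *\<^sub>R (conj_chart g (crd \<one> (D s)) - e0)) \<longlongrightarrow> c ^ k *\<^sub>R d) (at 0)"
  proof (rule Lim_transform_eventually)
    have "\<forall>\<^sub>F s in at 0. \<sigma> s \<noteq> 0" using \<sigma> by (simp add: filterlim_at)
    moreover have "\<forall>\<^sub>F s in at 0. D s \<in> nbh \<one>" using D by (simp add: converges_def)
    ultimately show "\<forall>\<^sub>F s in at 0. (\<sigma> s / s) ^ k *\<^sub>R (inverse (\<sigma> s ^ k) *\<^sub>R (crd \<one> (D (\<sigma> s)) - e0))
        = inverse (s ^ k) *\<^sub>R (conj_chart g (crd \<one> (D s)) - e0)"
      using conj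
      by eventually_elim (simp add: conj_chart_crd power_divide field_simps)
  qed
  ultimately show ?thesis by (intro tendsto_unique[OF trivial_limit_at]) auto
qed

text \<open>Upper and lower unipotents are treated at once, as \<open>L s = (s, 0)\<close> and
  \<open>L s = (0, s)\<close>. Since the entry (1,1) is 1, the curve stays in one chart, where it is
  the line \<open>(1, L s)\<close>; the entry (2,2) is forced by the determinant. So analyticity of
  \<open>\<phi>\<close> in coordinates restricts to the curve.\<close>

lemma SL2R_hom_analytic_curve:
  fixes L :: "real \<Rightarrow> real \<times> real"
  assumes \<phi>: "\<phi> \<in> banach_lie_hom SL2R G" and L: "bounded_linear L"
  defines "\<gamma> \<equiv> \<lambda>s. \<phi> (mat2 1 (fst (L s)) (snd (L s)) (1 + fst (L s) * snd (L s)))"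
  shows "real_analytic_at (\<lambda>s. crd \<one> (\<gamma> s)) 0" "converges (nhds 0) \<gamma> \<one>"
proof -
  let ?U = "{A :: real^2^2. det A = 1 \<and> A$1$1 \<noteq> 0}" and ?\<iota> = "\<lambda>A :: real^2^2. (A$1$1, A$1$2, A$2$1)"
  let ?M = "\<lambda>s. mat2 1 (fst (L s)) (snd (L s)) (1 + fst (L s) * snd (L s))"
  let ?W = "?\<iota> ` {x \<in> ?U. \<phi> x \<in> nbh \<one>}" and ?F = "crd \<one> \<circ> \<phi> \<circ> the_inv_into ?U ?\<iota>"
  have "(?U, ?\<iota>) \<in> atlas (manifold SL2R)" by (simp add: SL2R_def)
  then have an: "real_analytic_on ?F ?W"
    using \<phi> chart_at(1)[OF one_closed] unfolding banach_lie_hom_def analytic_map_def by blast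
  have \<phi>1: "\<phi> (mat2 1 0 0 1) = \<one>"
    using \<phi> hom_one[of \<phi> SL2R G] banach_lie_group_SL2R is_group
    by (simp add: banach_lie_hom_def banach_lie_group_def SL2R_def mat_1_eq_mat2)
  interpret L: bounded_linear L by (rule L)
  have inj: "inj_on ?\<iota> ?U"
  proof (rule inj_onI)
    fix A B assume *: "A \<in> ?U" "B \<in> ?U" "?\<iota> A = ?\<iota> B"
    then have "B$1$1 * A$2$2 = B$1$2 * B$2$1 + 1" "B$1$1 * B$2$2 = B$1$2 * B$2$1 + 1"
      by (simp_all add: det_2)
    then have "B$1$1 * A$2$2 = B$1$1 * B$2$2" by (rule trans[OF _ sym])
    then have "A$2$2 = B$2$2" using *(2) by simp
    with * show "A = B" by (intro mat2_eqI) auto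
  qed
  have U: "?M s \<in> ?U" "?\<iota> (?M s) = (1, L s)" for s by simp_all
  have W: "(1, L s) \<in> ?W \<longleftrightarrow> \<gamma> s \<in> nbh \<one>" for s
  proof
    assume "(1, L s) \<in> ?W"
    then obtain A where A: "A \<in> ?U" "\<phi> A \<in> nbh \<one>" "?\<iota> A = (1, L s)" by auto
    then have "A = ?M s" using inj_onD[OF inj, of A "?M s"] U by simp
    then show "\<gamma> s \<in> nbh \<one>" using A by (simp add: \<gamma>_def)
  next
    assume "\<gamma> s \<in> nbh \<one>"
    then show "(1, L s) \<in> ?W" using U[of s] unfolding \<gamma>_def by (metis (mono_tags, lifting) image_eqI mem_Collect_eq)
  qed
  have F: "?F (1, L s) = crd \<one> (\<gamma> s)" for s
    using the_inv_into_f_f[OF inj U(1)[of s]] by (simp add: \<gamma>_def U(2))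
  have mem: "(1, L 0) \<in> ?W" unfolding W by (simp add: \<gamma>_def L.zero \<phi>1 one_in_nbh)
  have "real_analytic_at ?F (1, L 0)" using bspec[OF conjunct2[OF an[unfolded real_analytic_on_def]] mem] .
  \<comment> \<open>Restriction to a line: the base point is translated to 0, then the linear map
    \<open>s \<mapsto> (0, L s)\<close> is inserted.\<close>
  from real_analytic_at_translate[OF this]
  have "real_analytic_at (\<lambda>h. ?F ((1, L 0) + h)) (0, L 0)" by (simp add: L.zero zero_prod_def)
  then have "real_analytic_at (\<lambda>s. ?F ((1, L 0) + (0, L s))) 0"
    by (rule real_analytic_at_compose_bounded_linear[where L="\<lambda>s. (0, L s)"])
      (intro bounded_linear_Pair bounded_linear_zero L)
  then show an0: "real_analytic_at (\<lambda>s. crd \<one> (\<gamma> s)) 0" using F by (simp add: L.zero)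
  have "isCont (\<lambda>s. crd \<one> (\<gamma> s)) 0" by (rule real_analytic_at_imp_isCont[OF an0])
  then have "((\<lambda>s. crd \<one> (\<gamma> s)) \<longlongrightarrow> crd \<one> (\<gamma> 0)) (nhds 0)"
    using tendsto_at_iff_tendsto_nhds[of "\<lambda>s. crd \<one> (\<gamma> s)" 0] by (simp add: isCont_def)
  then have t: "((\<lambda>s. crd \<one> (\<gamma> s)) \<longlongrightarrow> crd \<one> \<one>) (nhds 0)"
    by (simp add: \<gamma>_def L.zero \<phi>1)
  have "open ?W" using an by (simp add: real_analytic_on_def)
  moreover have "((\<lambda>s. (1, L s)) \<longlongrightarrow> (1, L 0)) (nhds 0)"
    by (intro tendsto_Pair tendsto_const L.tendsto filterlim_ident)
  ultimately have "\<forall>\<^sub>F s in nhds 0. (1, L s) \<in> ?W" using mem topological_tendstoD by blast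
  then show "converges (nhds 0) \<gamma> \<one>" using t unfolding W converges_def by simp
qed

end

section \<open>Homomorphisms from SL2\<close>

text \<open>On this open cell equality of two homomorphisms is reduced to the lower unipotents,
  since the second factor lies in \<open>B\<close>.\<close>

lemma SL2R_factorization:
  assumes "det A = 1" "A$1$1 \<noteq> 0"
  shows "A = mat2 1 0 (A$2$1 / A$1$1) 1 ** mat2 (A$1$1) (A$1$2) 0 (inverse (A$1$1))"
  using assms by (intro mat2_eqI) (auto simp: matrix_mult_2_nth det_2 field_simps)

context banach_lie_grp
begin

lemma SL2R_homs_eqI:
  assumes \<phi>: "\<phi> \<in> banach_lie_hom SL2R G" and \<psi>: "\<psi> \<in> banach_lie_hom SL2R G"
    and eq: "\<And>A. det A = 1 \<Longrightarrow> A$2$1 = 0 \<Longrightarrow> \<phi> A = \<psi> A"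
    and "det A = 1"
  shows "\<phi> A = \<psi> A"
proof -
  have closed: "f A \<in> carrier G" if "f \<in> banach_lie_hom SL2R G" "det A = 1" for f A
    using that by (auto simp: banach_lie_hom_def hom_def SL2R_def)
  have mult: "f (A ** B) = f A \<otimes> f B" if "f \<in> banach_lie_hom SL2R G" "det A = 1" "det B = 1" for f A B
    using that by (auto simp: banach_lie_hom_def hom_def SL2R_def)
  have one: "f (mat2 1 0 0 1) = \<one>" if "f \<in> banach_lie_hom SL2R G" for f
    using that hom_one[of f SL2R G] banach_lie_group_SL2R is_group
    by (simp add: banach_lie_hom_def banach_lie_group_def SL2R_def mat_1_eq_mat2)
  let ?n = "\<lambda>s. mat2 1 0 s 1" and ?u = "\<lambda>t. mat2 1 t 0 1" and ?t = "\<lambda>a. mat2 a 0 0 (inverse a)"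
  have inv_n: "inv (f (?n s)) = f (?n (- s))" and inv_u: "inv (f (?u s)) = f (?u (- s))"
    if f: "f \<in> banach_lie_hom SL2R G" for f s
  proof -
    have "f (?n (- s)) \<otimes> f (?n s) = \<one>" "f (?u (- s)) \<otimes> f (?u s) = \<one>"
      using f by (simp_all flip: mult) (simp_all add: mat2_mult one)
    then show "inv (f (?n s)) = f (?n (- s))" "inv (f (?u s)) = f (?u (- s))"
      using closed[OF f] by (simp_all add: inv_equality)
  qed
  have bl: "bounded_linear (\<lambda>s::real. (0::real, s))" "bounded_linear (\<lambda>s::real. (s, 0::real))"
    by (intro bounded_linear_Pair bounded_linear_zero bounded_linear_ident)+
  have conv_n: "converges (nhds 0) (\<lambda>s. f (?n s)) \<one>" and an_n: "real_analytic_at (\<lambda>s. crd \<one> (f (?n s))) 0"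
    and conv_u: "converges (nhds 0) (\<lambda>s. f (?u s)) \<one>"
    if f: "f \<in> banach_lie_hom SL2R G" for f
    using SL2R_hom_analytic_curve[OF f bl(1)] SL2R_hom_analytic_curve[OF f bl(2)] by simp_all
  have conv_inv: "converges (nhds 0) (\<lambda>s. inv (f (?n s))) \<one>" "converges (nhds 0) (\<lambda>s. inv (f (?u s))) \<one>"
    if f: "f \<in> banach_lie_hom SL2R G" for f
  proof -
    \<comment> \<open>The inverse curves are the original ones traversed backwards.\<close>
    have "filterlim uminus (nhds 0) (nhds (0::real))"
      using tendsto_minus[OF filterlim_ident, of "0::real"] by simp
    then show "converges (nhds 0) (\<lambda>s. inv (f (?n s))) \<one>" "converges (nhds 0) (\<lambda>s. inv (f (?u s))) \<one>"
      using converges_compose[OF conv_n[OF f]] converges_compose[OF conv_u[OF f]]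
      by (simp_all add: inv_n inv_u f)
  qed
  \<comment> \<open>Limits that include the point 0 are weakened to punctured ones, as division by
    powers of \<open>s\<close> requires.\<close>
  note at0 = converges_compose[OF _ tendsto_ident_at, of "0::real" _ _ UNIV]
  have near0: "\<forall>\<^sub>F s in nhds 0. \<phi> (?n s) = \<psi> (?n s)"
  proof -
    let ?f = "\<lambda>s. crd \<one> (\<phi> (?n s)) + - crd \<one> (\<psi> (?n s))"
    have an: "real_analytic_at ?f 0"
      by (intro real_analytic_at_add real_analytic_at_uminus an_n \<phi> \<psi>)
    have "?f 0 = 0" by (simp add: one \<phi> \<psi>)
    with an show ?thesis
    proof (cases rule: real_analytic_at_0_order)
      case 1
      have "\<forall>\<^sub>F s in nhds 0. \<phi> (?n s) \<in> nbh \<one>" "\<forall>\<^sub>F s in nhds 0. \<psi> (?n s) \<in> nbh \<one>"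
        using conv_n \<phi> \<psi> by (auto simp: converges_def)
      with 1 show ?thesis
        by eventually_elim (use chart_nbh(3)[OF one_closed] in \<open>auto dest: inj_onD\<close>)
    next
      case (2 k d)
      define D where "D = (\<lambda>s. \<phi> (?n s) \<otimes> inv (\<psi> (?n s)))"
      have D: "converges (at 0) D \<one>" "((\<lambda>s. inverse (s ^ k) *\<^sub>R (crd \<one> (D s) - e0)) \<longlongrightarrow> d) (at 0)"
        unfolding D_def using 2(3)
        by (intro tendsto_crd_quotient at0 conv_n conv_inv \<phi> \<psi>; simp)+
      \<comment> \<open>\<open>B\<close> and \<open>C\<close> are upper triangular, so
        \<open>\<phi>\<close> and \<open>\<psi>\<close> take the same values there. Both curves are
        multiplied by the same two factors, and the right one cancels in the quotient.\<close>
      have conj_D: "D s' = \<phi> B \<otimes> D s \<otimes> inv (\<phi> B)"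
        if B: "det B = 1" "B$2$1 = 0" "det C = 1" "C$2$1 = 0" "B ** ?n s = ?n s' ** C" for B C s s'
      proof -
        have c: "f (?n s') = \<phi> B \<otimes> f (?n s) \<otimes> inv (\<phi> C)"
          if f: "f \<in> banach_lie_hom SL2R G" "\<phi> B = f B" "\<phi> C = f C" for f
        proof -
          have "f B \<otimes> f (?n s) = f (?n s') \<otimes> f C"
            using arg_cong[OF B(5), of f] B(1,3) f(1) by (simp add: mult)
          then show ?thesis using closed[OF f(1)] B f(2,3) by (simp add: inv_solve_right)
        qed
        have "\<phi> (?n s') = \<phi> B \<otimes> \<phi> (?n s) \<otimes> inv (\<phi> C)" "\<psi> (?n s') = \<phi> B \<otimes> \<psi> (?n s) \<otimes> inv (\<phi> C)"
          using c[OF \<phi> refl refl] c[OF \<psi> eq[OF B(1,2)] eq[OF B(3,4)]] .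
        moreover have "\<phi> B \<in> carrier G" "\<phi> C \<in> carrier G" "\<phi> (?n s) \<in> carrier G" "\<psi> (?n s) \<in> carrier G"
          using closed \<phi> \<psi> B by simp_all
        ultimately show ?thesis
          by (simp add: D_def inv_mult_group m_assoc inv_solve_left')
      qed
      have "d = 0"
      proof (rule no_negative_highest_weight_vector[where \<rho>="\<lambda>A. Ad (\<phi> A)", OF _ _ _ _ _ _ 2(1)])
        fix A :: "real^2^2" assume "det A = 1"
        then show "bounded_linear (Ad (\<phi> A))" by (intro bounded_linear_Ad closed \<phi>)
        fix B :: "real^2^2" and v assume "det B = 1"
        with \<open>det A = 1\<close> show "Ad (\<phi> (A ** B)) v = Ad (\<phi> A) (Ad (\<phi> B) v)"
          by (simp add: mult \<phi> Ad_mult closed)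
      next
        fix a :: real assume a: "a \<noteq> 0"
        \<comment> \<open>Moving \<open>?t a\<close> past \<open>?n s\<close> rescales the lower
          entry by \<open>a^(-2)\<close> and leaves \<open>?t a\<close> itself on the right, so
          \<open>B\<close> and \<open>C\<close> coincide.\<close>
        show "Ad (\<phi> (?t a)) d = ((inverse a)\<^sup>2) ^ k *\<^sub>R d"
        proof (rule Ad_scaling[OF _ D, of _ "\<lambda>s. s * (inverse a)\<^sup>2"])
          show "\<phi> (?t a) \<in> carrier G" using a by (intro closed \<phi>) simp
          show "filterlim (\<lambda>s. s * (inverse a)\<^sup>2) (at 0) (at 0)"
          proof (rule filterlim_atI)
            show "((\<lambda>s. s * (inverse a)\<^sup>2) \<longlongrightarrow> 0) (at 0)" by (auto intro!: tendsto_eq_intros)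
            show "\<forall>\<^sub>F s in at 0. s * (inverse a)\<^sup>2 \<noteq> 0" using a by (simp add: eventually_at_filter)
          qed
          show "((\<lambda>s. s * (inverse a)\<^sup>2 / s) \<longlongrightarrow> (inverse a)\<^sup>2) (at 0)"
            by (rule tendsto_eventually) (simp add: eventually_at_filter)
          show "\<forall>\<^sub>F s in at 0. D (s * (inverse a)\<^sup>2) = \<phi> (?t a) \<otimes> D s \<otimes> inv (\<phi> (?t a))"
            by (intro always_eventually allI conj_D[of "?t a" "?t a"])
              (use a in \<open>simp_all add: mat2_mult power2_eq_square field_simps\<close>)
        qed
      next
        fix t :: real
        have ne: "\<forall>\<^sub>F s in at 0. 1 + t * s \<noteq> 0"
        proof -
          have "((\<lambda>s. 1 + t * s) \<longlongrightarrow> 1) (at 0)" by (auto intro!: tendsto_eq_intros)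
          then show ?thesis by (rule tendsto_imp_eventually_ne) simp
        qed
        \<comment> \<open>Moving \<open>?u t\<close> past \<open>?n s\<close> changes
          \<open>s\<close> to \<open>s / (1 + t * s)\<close>, whose ratio to \<open>s\<close> tends
          to 1; hence no factor appears, whatever \<open>k\<close> is.\<close>
        have "Ad (\<phi> (?u t)) d = 1 ^ k *\<^sub>R d"
        proof (rule Ad_scaling[OF _ D, of _ "\<lambda>s. s / (1 + t * s)"])
          show "\<phi> (?u t) \<in> carrier G" by (intro closed \<phi>) simp
          show "filterlim (\<lambda>s. s / (1 + t * s)) (at 0) (at 0)"
          proof (rule filterlim_atI)
            show "((\<lambda>s. s / (1 + t * s)) \<longlongrightarrow> 0) (at 0)" by (auto intro!: tendsto_eq_intros)
            show "\<forall>\<^sub>F s in at 0. s / (1 + t * s) \<noteq> 0"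
              using ne eventually_neq_at_within[of 0] by eventually_elim simp
          qed
          have "((\<lambda>s. 1 / (1 + t * s)) \<longlongrightarrow> 1) (at 0)" by (auto intro!: tendsto_eq_intros)
          then show "((\<lambda>s. s / (1 + t * s) / s) \<longlongrightarrow> 1) (at 0)"
          proof (rule Lim_transform_eventually)
            show "\<forall>\<^sub>F s in at 0. 1 / (1 + t * s) = s / (1 + t * s) / s"
              by (simp add: eventually_at_filter)
          qed
          show "\<forall>\<^sub>F s in at 0. D (s / (1 + t * s)) = \<phi> (?u t) \<otimes> D s \<otimes> inv (\<phi> (?u t))"
            using ne
          proof eventually_elim
            case (elim s)
            \<comment> \<open>The second matrix is the upper triangular factor of
              \<open>?u t ** ?n s\<close>, read off from the first row \<open>(1 + t * s, t)\<close>
              of that product.\<close>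
            show ?case
              by (rule conj_D[of "?u t" "mat2 (1 + t * s) t 0 (inverse (1 + t * s))"])
                (use elim in \<open>simp_all add: mat2_mult\<close>, intro mat2_eqI, simp_all add: field_simps)
          qed
        qed
        then show "Ad (\<phi> (?u t)) d = d" by simp
      next
        show "\<forall>\<^sub>F s in nhds 0. \<forall>v. norm (Ad (\<phi> (?n s)) v - v) \<le> norm v / 2"
          using eventually_Ad_near_id[OF conv_n[OF \<phi>] conv_inv(1)[OF \<phi>], of "1/2"] by simp
        show "\<forall>\<^sub>F s in nhds 0. \<forall>v. norm (Ad (\<phi> (?u s)) v - v) \<le> norm v / 2"
          using eventually_Ad_near_id[OF conv_u[OF \<phi>] conv_inv(2)[OF \<phi>], of "1/2"] by simp
      qed
      with 2(2) show ?thesis by simp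
    qed
  qed
  have lower: "\<phi> (?n s) = \<psi> (?n s)" for s
  proof -
    obtain r where r: "0 < r" "\<And>s. \<bar>s\<bar> < r \<Longrightarrow> \<phi> (?n s) = \<psi> (?n s)"
      using near0 unfolding eventually_nhds_metric by (auto simp: dist_norm)
    \<comment> \<open>Diagonal conjugation contracts any \<open>s\<close> into the neighbourhood
      where equality is known: this \<open>a\<close> gives \<open>|s * a^2| < r\<close>, and the
      added 1 covers \<open>s = 0\<close>.\<close>
    define a where "a = sqrt (r / (2 * (\<bar>s\<bar> + 1)))"
    have a: "0 < a" "a\<^sup>2 = r / (2 * (\<bar>s\<bar> + 1))" using r(1) by (simp_all add: a_def)
    have "\<bar>s * a\<^sup>2\<bar> = r * (\<bar>s\<bar> / (2 * (\<bar>s\<bar> + 1)))" using r(1) by (simp add: a(2) abs_mult)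
    also have "\<dots> < r * 1" using r(1) by (intro mult_strict_left_mono) (auto simp: field_simps)
    finally have "\<phi> (?n (s * a\<^sup>2)) = \<psi> (?n (s * a\<^sup>2))" using r(2) by simp
    moreover have "?n s = ?t a ** (?n (s * a\<^sup>2) ** ?t (inverse a))"
      using a(1) by (simp add: mat2_mult power2_eq_square field_simps)
    moreover have "\<phi> (?t a) = \<psi> (?t a)" "\<phi> (?t (inverse a)) = \<psi> (?t (inverse a))"
      using a(1) by (intro eq; simp)+
    ultimately show ?thesis using a(1) \<phi> \<psi> by (simp add: mult det_mul)
  qed
  have nz: "\<phi> A = \<psi> A" if A: "det A = 1" "A$1$1 \<noteq> 0" for A
  proof -
    let ?B = "mat2 (A$1$1) (A$1$2) 0 (inverse (A$1$1))"
    have "\<phi> ?B = \<psi> ?B" using A by (intro eq) simp_all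
    then have "\<phi> (?n (A$2$1 / A$1$1) ** ?B) = \<psi> (?n (A$2$1 / A$1$1) ** ?B)"
      using A lower by (simp add: mult \<phi> \<psi>)
    then show ?thesis using SL2R_factorization[OF A] by simp
  qed
  show ?thesis
  proof (cases "A$1$1 = 0")
    case True
    \<comment> \<open>If the entry (1,1) vanishes, the entry (1,2) does not; adding the second
      column to the first moves the matrix into the open cell.\<close>
    define A' where "A' = A ** ?n 1"
    have "det A' = 1" using \<open>det A = 1\<close> by (simp add: A'_def det_mul)
    moreover have "A'$1$1 \<noteq> 0"
      using True \<open>det A = 1\<close> by (auto simp: A'_def matrix_mult_2_nth det_2)
    ultimately have "\<phi> (A' ** ?n (-1)) = \<psi> (A' ** ?n (-1))"
      using nz[of A'] lower \<phi> \<psi> by (simp add: mult)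
    moreover have "A' ** ?n (-1) = A" by (intro mat2_eqI) (simp_all add: A'_def matrix_mult_2_nth)
    ultimately show ?thesis by simp
  qed (use nz \<open>det A = 1\<close> in blast)
qed

end

theorem theorem6p3:
  shows "banach_lie_epimorphism TYPE('k) TYPE('z::banach) SL2R_upper SL2R (\<lambda>A. A)"
  unfolding banach_lie_epimorphism_def
proof (intro conjI allI impI ballI)
  fix K :: "('k, 'z) lie_group" and \<phi> \<psi> and A
  assume K: "banach_lie_group K" and h: "\<phi> \<in> banach_lie_hom SL2R K" "\<psi> \<in> banach_lie_hom SL2R K"
    and eq: "\<forall>x\<in>carrier SL2R_upper. \<phi> x = \<psi> x" and A: "A \<in> carrier SL2R"
  interpret banach_lie_grp K by unfold_locales (rule K)
  show "\<phi> A = \<psi> A"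
    by (rule SL2R_homs_eqI[OF h]) (use eq A in \<open>simp_all add: SL2R_def SL2R_upper_def\<close>)
qed (rule banach_lie_group_SL2R_upper banach_lie_group_SL2R inclusion_banach_lie_hom)+

end
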